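(* Let $2\le Q\le7$ be an integer. Then the (generalized) Perron Frobenius eigenvector of $A_{\mathbb G^{Q,2}}$ is unique up to a multiplicative constant, and it is a multiple of $$v(x)=a(\lambda_* )^{d(x,\mathbb Z)},\qquad x\in\mathbb G^Q,$$ where $\lambda_*=\frac{3-\sqrt5}{2}Q+\sqrt5$ and $$a(\lambda)=\frac{1-\sqrt{1-\frac{4(Q-1)}{\lambda^2}}}{\frac{2(Q-1)}{\lambda}}.$$ Moreover, $v$ is the pointwise limit, as $n\to\infty$, of the Perron Frobenius eigenvectors $v_n\in\ell^2$ of $A_{X_n}$ ($n$ sufficiently large), normalized by $v_n(0)=1$, where $X_n$ is the graph obtained from $\mathbb G^Q$ by adding one self-loop at each vertex of the segment $S_n\subset\mathbb Z$ made of the $2n+1$ points of $\mathbb Z$ centered at the root $0$.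
   Context: For a graph $X$ (undirected, self-loops allowed) the adjacency operator $A_X$ acts on $\ell^2(VX)$ and its matrix entry $A_{xy}$ is the number of edges joining $x$ and $y$; a single self-loop at $x$ contributes $A_{xx}=1$. $\mathbb G^Q$ is the homogeneous Cayley tree of order $Q$ (the infinite tree in which every vertex has degree $Q$), with graph distance $d$. $\mathbb G^{Q,2}$ is the graph obtained from $\mathbb G^Q$ by adding one self-loop at each vertex of a fixed subtree isomorphic to $\mathbb Z$ (a bi-infinite path) containing the root $0$; this subtree is denoted simply by $\mathbb Z\subset\mathbb G^Q$. For a bounded operator $B$ on $\ell^2(VX)$ with nonnegative entries, a (generalized) Perron Frobenius eigenvector is a family $\{v(x)\}_{x\in VX}$ with positive entries, not necessarily in $\ell^2$, such that $\sum_{y}B_{xy}v(y)=\|B\|v(x)$ for all $x\in VX$. *)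

theory Defs
  imports "HOL-Analysis.Analysis"
begin

section \<open>Graphs\<close>

text \<open>
  An undirected graph on the vertex type \<open>'v\<close> (every element of the type is a vertex) is given by
  its set of edges.  An edge between distinct vertices is a set \<open>{x, y}\<close>; a self-loop at \<open>x\<close>
  is the singleton \<open>{x} = {x, x}\<close>.  Thus there is at most one edge joining two given vertices
  and at most one self-loop at each vertex.
\<close>

type_synonym 'v graph = "'v set set"

definition wf_graph :: "'v graph \<Rightarrow> bool" where
  "wf_graph E \<longleftrightarrow> (\<forall>e\<in>E. \<exists>x y. e = {x, y})"

text \<open>The matrix entry at \<open>(x, y)\<close> is the number of edges joining \<open>x\<close> and \<open>y\<close>.\<close>

definition adjacency :: "'v graph \<Rightarrow> 'v \<Rightarrow> 'v \<Rightarrow> real" where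
  "adjacency E x y = real (card {e \<in> E. e = {x, y}})"

definition graph_walk :: "'v graph \<Rightarrow> 'v list \<Rightarrow> bool" where
  "graph_walk E xs \<longleftrightarrow> xs \<noteq> [] \<and> successively (\<lambda>x y. {x, y} \<in> E) xs"

definition graph_connected :: "'v graph \<Rightarrow> bool" where
  "graph_connected E \<longleftrightarrow> (\<forall>x y. \<exists>xs. graph_walk E xs \<and> hd xs = x \<and> last xs = y)"

definition graph_cycle :: "'v graph \<Rightarrow> 'v list \<Rightarrow> bool" where
  "graph_cycle E xs \<longleftrightarrow>
     graph_walk E xs \<and> distinct xs \<and> 3 \<le> length xs \<and> {last xs, hd xs} \<in> E"

definition is_tree :: "'v graph \<Rightarrow> bool" where
  "is_tree E \<longleftrightarrow>
     wf_graph E \<and> (\<forall>x. {x} \<notin> E) \<and> graph_connected E \<and> (\<nexists>xs. graph_cycle E xs)"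

definition homogeneous_tree :: "nat \<Rightarrow> 'v graph \<Rightarrow> bool" where
  "homogeneous_tree Q E \<longleftrightarrow>
     is_tree E \<and> (\<forall>x. finite {e \<in> E. x \<in> e} \<and> card {e \<in> E. x \<in> e} = Q)"

text \<open>
  The distance is meaningful for connected graphs only.  The infimum in \<open>set_dist\<close> is taken in the
  natural numbers, hence it is a minimum whenever \<open>S\<close> is nonempty.
\<close>

definition graph_dist :: "'v graph \<Rightarrow> 'v \<Rightarrow> 'v \<Rightarrow> nat" where
  "graph_dist E x y =
     (LEAST k. \<exists>xs. graph_walk E xs \<and> hd xs = x \<and> last xs = y \<and> length xs = Suc k)"

definition set_dist :: "'v graph \<Rightarrow> 'v \<Rightarrow> 'v set \<Rightarrow> nat" where
  "set_dist E x S = (INF z\<in>S. graph_dist E x z)"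

text \<open>
  A bi-infinite path, i.e. a subgraph isomorphic to \<open>\<int>\<close>, is given by its parametrization.  In a tree
  the subgraph induced on \<open>range p\<close> has no further edges, so only its vertex set matters.
\<close>

definition biinfinite_path :: "'v graph \<Rightarrow> (int \<Rightarrow> 'v) \<Rightarrow> bool" where
  "biinfinite_path E p \<longleftrightarrow> inj p \<and> (\<forall>i. {p i, p (i + 1)} \<in> E)"

definition add_loops :: "'v graph \<Rightarrow> 'v set \<Rightarrow> 'v graph" where
  "add_loops E S = E \<union> {{x} |x. x \<in> S}"


section \<open>Operators on \<open>\<ell>\<close>2 given by matrices\<close>

definition ell2 :: "('v \<Rightarrow> complex) set" where
  "ell2 = {f. (\<lambda>x. (cmod (f x))\<^sup>2) summable_on UNIV}"

definition ell2_norm :: "('v \<Rightarrow> complex) \<Rightarrow> real" where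
  "ell2_norm f = sqrt (\<Sum>\<^sub>\<infinity>x. (cmod (f x))\<^sup>2)"

definition mat_op :: "('v \<Rightarrow> 'v \<Rightarrow> real) \<Rightarrow> ('v \<Rightarrow> complex) \<Rightarrow> 'v \<Rightarrow> complex" where
  "mat_op B f x = (\<Sum>\<^sub>\<infinity>y. complex_of_real (B x y) * f y)"

definition bounded_mat :: "('v \<Rightarrow> 'v \<Rightarrow> real) \<Rightarrow> bool" where
  "bounded_mat B \<longleftrightarrow>
     (\<forall>f\<in>ell2. (\<forall>x. (\<lambda>y. complex_of_real (B x y) * f y) summable_on UNIV) \<and> mat_op B f \<in> ell2) \<and>
     (\<exists>C. \<forall>f\<in>ell2. ell2_norm (mat_op B f) \<le> C * ell2_norm f)"

text \<open>The operator norm; like any supremum of reals it is meaningful only for bounded operators.\<close>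

definition mat_norm :: "('v \<Rightarrow> 'v \<Rightarrow> real) \<Rightarrow> real" where
  "mat_norm B = (SUP f\<in>{f \<in> ell2. ell2_norm f \<le> 1}. ell2_norm (mat_op B f))"

text \<open>
  (Generalized) Perron Frobenius eigenvectors; they need not be square summable.  The standing
  assumption that the operator is bounded with nonnegative entries is part of the definition.
\<close>

definition perron_frobenius :: "('v \<Rightarrow> 'v \<Rightarrow> real) \<Rightarrow> ('v \<Rightarrow> real) \<Rightarrow> bool" where
  "perron_frobenius B v \<longleftrightarrow>
     bounded_mat B \<and> (\<forall>x y. 0 \<le> B x y) \<and> (\<forall>x. 0 < v x) \<and>
     (\<forall>x. ((\<lambda>y. B x y * v y) has_sum mat_norm B * v x) UNIV)"

text \<open>A square summable Perron Frobenius eigenvector with value 1 at the root \<open>r\<close>.\<close>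

definition normalized_ell2_pf :: "('v \<Rightarrow> 'v \<Rightarrow> real) \<Rightarrow> 'v \<Rightarrow> ('v \<Rightarrow> real) \<Rightarrow> bool" where
  "normalized_ell2_pf B r w \<longleftrightarrow>
     perron_frobenius B w \<and> (\<lambda>x. complex_of_real (w x)) \<in> ell2 \<and> w r = 1"


section \<open>The constants\<close>

definition lambda_star :: "nat \<Rightarrow> real" where
  "lambda_star Q = (3 - sqrt 5) / 2 * real Q + sqrt 5"

definition a_fun :: "nat \<Rightarrow> real \<Rightarrow> real" where
  "a_fun Q l = (1 - sqrt (1 - 4 * (real Q - 1) / l\<^sup>2)) / (2 * (real Q - 1) / l)"

end

(*
  Put a = (3 - sqrt 5) / 2. Off the core (the set of vertices carrying loops) a function that is
  multiplied by a at each step away from the core is an eigenfunction for (Q - 1) a + 1 / a, and every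
  positive eigenfunction decreases at most by the factor a per step, provided (Q - 1) a^2 < 1. This
  reduces the problem to the path. On the segment with 2 n + 1 loops the eigenvector is cos (theta i),
  where a + 1 / a = 1 + 2 cos theta and cos ((n + 1) theta) = a cos (n theta); such a theta in
  [0, pi / (2 n + 2)] exists by the intermediate value theorem. It is square summable, so by the Schur
  test its eigenvalue is the norm. Letting n tend to infinity, the norm for the whole path is at least
  lambda_*, and the Schur test with v gives equality. A positive eigenfunction u for lambda_*
  restricts to a concave positive function on Z, hence to a constant c, and then u - c v is a
  nonnegative eigenfunction with a zero, hence zero.
*)

theory Submission
  imports Defs
begin

section \<open>Adjacency operators and the Schur test\<close>

text \<open>A loop \<open>{x} = {x, x}\<close> puts \<open>x\<close> into its own neighbourhood, so
  a sum over \<open>nbrs E x\<close> is the full row of the adjacency matrix at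
  \<open>x\<close>.\<close>

definition nbrs :: "'v graph \<Rightarrow> 'v \<Rightarrow> 'v set" where
  "nbrs E x = {y. {x, y} \<in> E}"

lemma nbrs_sym: "y \<in> nbrs E x \<longleftrightarrow> x \<in> nbrs E y"
  by (simp add: nbrs_def insert_commute)

lemma adjacency_eq: "adjacency E x y = (if y \<in> nbrs E x then 1 else 0)"
proof -
  have "{e \<in> E. e = {x, y}} = (if {x, y} \<in> E then {{x, y}} else {})"
    by auto
  thus ?thesis
    by (simp add: adjacency_def nbrs_def)
qed

lemma has_sum_adjacency:
  fixes f :: "'v \<Rightarrow> 'b::real_normed_algebra_1"
  assumes "finite (nbrs E x)"
  shows "((\<lambda>y. of_real (adjacency E x y) * f y) has_sum (\<Sum>y\<in>nbrs E x. f y)) UNIV"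
proof -
  have "(f has_sum (\<Sum>y\<in>nbrs E x. f y)) (nbrs E x)"
    using assms by (rule has_sum_finite)
  also have "?this \<longleftrightarrow> ?thesis"
    by (rule has_sum_cong_neutral) (auto simp: adjacency_eq)
  finally show ?thesis .
qed

lemma mat_op_adjacency:
  assumes "finite (nbrs E x)"
  shows "mat_op (adjacency E) f x = (\<Sum>y\<in>nbrs E x. f y)"
  unfolding mat_op_def using has_sum_adjacency[OF assms, of f] by (simp add: infsumI)

lemma ell2_norm_nonneg: "0 \<le> ell2_norm f"
  by (simp add: ell2_norm_def infsum_nonneg)

lemma ell2_norm_power2: "(ell2_norm f)\<^sup>2 = (\<Sum>\<^sub>\<infinity>x. (cmod (f x))\<^sup>2)"
  by (simp add: ell2_norm_def infsum_nonneg)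

lemma ell2_norm_le_iff: "0 \<le> c \<Longrightarrow> ell2_norm f \<le> c \<longleftrightarrow> (\<Sum>\<^sub>\<infinity>x. (cmod (f x))\<^sup>2) \<le> c\<^sup>2"
  by (metis ell2_norm_nonneg ell2_norm_power2 power2_le_imp_le power_mono)

lemma ell2_by_finite_sums:
  assumes "\<And>F. finite F \<Longrightarrow> (\<Sum>x\<in>F. (cmod (f x))\<^sup>2) \<le> c\<^sup>2" "0 \<le> c"
  shows "f \<in> ell2" "ell2_norm f \<le> c"
proof -
  have s: "(\<lambda>x. (cmod (f x))\<^sup>2) summable_on UNIV"
    by (rule nonneg_bdd_above_summable_on) (auto intro!: bdd_aboveI[of _ "c\<^sup>2"] assms)
  thus "f \<in> ell2"
    by (simp add: ell2_def)
  show "ell2_norm f \<le> c"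
    using assms(2) by (simp add: ell2_norm_le_iff infsum_le_finite_sums[OF s] assms(1))
qed

lemma ell2_finite_sum_le:
  assumes "f \<in> ell2" "finite F"
  shows "(\<Sum>x\<in>F. (cmod (f x))\<^sup>2) \<le> (ell2_norm f)\<^sup>2"
  unfolding ell2_norm_power2
  using assms by (intro finite_sum_le_infsum) (auto simp: ell2_def)

text \<open>Cauchy-Schwarz with weights \<open>sqrt (u y)\<close> bounds one entry of the image;
  after summation over \<open>x\<close>, symmetry of the matrix lets \<open>super\<close> be used a
  second time. Any positive supersolution can be the weight, square summable or not.\<close>

lemma schur_test:
  fixes E :: "'v graph" and u :: "'v \<Rightarrow> real"
  assumes fin: "\<And>x. finite (nbrs E x)"
    and pos: "\<And>x. 0 < u x"
    and super: "\<And>x. (\<Sum>y\<in>nbrs E x. u y) \<le> \<mu> * u x"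
    and f: "f \<in> ell2"
  shows "mat_op (adjacency E) f \<in> ell2"
    and "ell2_norm (mat_op (adjacency E) f) \<le> \<mu> * ell2_norm f"
proof -
  have "0 \<le> \<mu> * u x" for x
    using sum_nonneg[of "nbrs E x" u] super[of x] pos less_imp_le order_trans by metis
  hence \<mu>: "0 \<le> \<mu>"
    using pos by (metis zero_le_mult_iff not_less)
  define g where "g = (\<lambda>y. (cmod (f y))\<^sup>2 / u y)"
  have g: "0 \<le> g y" for y
    using pos[of y] by (simp add: g_def)
  have pointwise: "(cmod (mat_op (adjacency E) f x))\<^sup>2 \<le> (\<Sum>y\<in>nbrs E x. \<mu> * (u x * g y))" for x
  proof -
    have "cmod (mat_op (adjacency E) f x) \<le> (\<Sum>y\<in>nbrs E x. sqrt (u y) * (cmod (f y) / sqrt (u y)))"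
      using pos by (simp add: mat_op_adjacency[OF fin] norm_sum less_imp_neq[symmetric])
    hence "(cmod (mat_op (adjacency E) f x))\<^sup>2
        \<le> (\<Sum>y\<in>nbrs E x. sqrt (u y) * (cmod (f y) / sqrt (u y)))\<^sup>2"
      by (rule power_mono) simp
    also have "\<dots> \<le> (\<Sum>y\<in>nbrs E x. (sqrt (u y))\<^sup>2) * (\<Sum>y\<in>nbrs E x. (cmod (f y) / sqrt (u y))\<^sup>2)"
      by (rule Cauchy_Schwarz_ineq_sum)
    also have "\<dots> = (\<Sum>y\<in>nbrs E x. u y) * (\<Sum>y\<in>nbrs E x. g y)"
      using pos by (simp add: g_def power_divide less_imp_le)
    also have "\<dots> \<le> \<mu> * u x * (\<Sum>y\<in>nbrs E x. g y)"
      by (intro mult_right_mono super sum_nonneg g)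
    finally show ?thesis
      by (simp add: sum_distrib_left mult.assoc)
  qed
  have bound: "(\<Sum>x\<in>F. (cmod (mat_op (adjacency E) f x))\<^sup>2) \<le> (\<mu> * ell2_norm f)\<^sup>2"
    if F: "finite F" for F
  proof -
    \<comment> \<open>\<open>M\<close> holds all columns met by the rows in \<open>F\<close>. It is
      finite, so the double sum can be swapped without a question of convergence.\<close>
    define M where "M = (\<Union>x\<in>F. nbrs E x)"
    have M: "finite M"
      using F fin by (simp add: M_def)
    have "(\<Sum>x\<in>F. (cmod (mat_op (adjacency E) f x))\<^sup>2)
        \<le> (\<Sum>x\<in>F. \<Sum>y\<in>nbrs E x. \<mu> * (u x * g y))"
      by (intro sum_mono pointwise)
    also have "\<dots> = (\<Sum>x\<in>F. \<Sum>y | y \<in> M \<and> y \<in> nbrs E x. \<mu> * (u x * g y))"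
      by (intro sum.cong) (auto simp: M_def)
    also have "\<dots> = (\<Sum>y\<in>M. \<Sum>x | x \<in> F \<and> y \<in> nbrs E x. \<mu> * (u x * g y))"
      by (rule sum.swap_restrict[OF F M])
    \<comment> \<open>By symmetry the rows in \<open>F\<close> that meet column \<open>y\<close> lie
      in \<open>nbrs E y\<close>, and the added terms are nonnegative.\<close>
    also have "\<dots> \<le> (\<Sum>y\<in>M. \<Sum>x\<in>nbrs E y. \<mu> * (u x * g y))"
      using pos g \<mu> by (intro sum_mono sum_mono2 fin) (auto simp: nbrs_sym[of _ E] less_imp_le)
    also have "\<dots> = (\<Sum>y\<in>M. \<mu> * g y * (\<Sum>x\<in>nbrs E y. u x))"
      by (simp add: sum_distrib_left mult_ac)
    also have "\<dots> \<le> (\<Sum>y\<in>M. \<mu> * g y * (\<mu> * u y))"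
      by (intro sum_mono mult_left_mono super mult_nonneg_nonneg \<mu> g)
    also have "\<dots> = \<mu>\<^sup>2 * (\<Sum>y\<in>M. (cmod (f y))\<^sup>2)"
      using pos by (simp add: g_def sum_distrib_left power2_eq_square less_imp_neq[symmetric] mult_ac)
    also have "\<dots> \<le> \<mu>\<^sup>2 * (ell2_norm f)\<^sup>2"
      by (intro mult_left_mono ell2_finite_sum_le f M) simp
    finally show ?thesis
      by (simp add: power_mult_distrib)
  qed
  show "mat_op (adjacency E) f \<in> ell2" "ell2_norm (mat_op (adjacency E) f) \<le> \<mu> * ell2_norm f"
    using ell2_by_finite_sums[OF bound mult_nonneg_nonneg[OF \<mu> ell2_norm_nonneg]] by auto
qed

lemma bounded_mat_adjacency:
  fixes E :: "'v graph" and u :: "'v \<Rightarrow> real"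
  assumes "\<And>x. finite (nbrs E x)" "\<And>x. 0 < u x"
    and "\<And>x. (\<Sum>y\<in>nbrs E x. u y) \<le> \<mu> * u x"
  shows "bounded_mat (adjacency E)"
  unfolding bounded_mat_def
  using schur_test[OF assms] has_sum_imp_summable[OF has_sum_adjacency[OF assms(1), where 'b = complex]]
  by blast

lemma mat_norm_adjacency_le:
  fixes E :: "'v graph" and u :: "'v \<Rightarrow> real"
  assumes "\<And>x. finite (nbrs E x)" "\<And>x. 0 < u x"
    and "\<And>x. (\<Sum>y\<in>nbrs E x. u y) \<le> \<mu> * u x" and "0 \<le> \<mu>"
  shows "mat_norm (adjacency E) \<le> \<mu>"
  unfolding mat_norm_def
proof (rule cSUP_least)
  have "(\<lambda>_. 0) \<in> {f \<in> ell2. ell2_norm f \<le> 1}"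
    by (simp add: ell2_def ell2_norm_def)
  thus "{f \<in> ell2. ell2_norm f \<le> 1} \<noteq> {}"
    by blast
next
  fix f :: "'v \<Rightarrow> complex" assume "f \<in> {f \<in> ell2. ell2_norm f \<le> 1}"
  thus "ell2_norm (mat_op (adjacency E) f) \<le> \<mu>"
    using schur_test(2)[OF assms(1-3), of f] mult_left_le[of "ell2_norm f" \<mu>] assms(4) by simp
qed

text \<open>A positive square summable subsolution serves as test vector: once normalized, its image
  dominates \<open>\<mu>\<close> times it entrywise. The supersolution \<open>u\<close> with
  constant \<open>C\<close> makes the operator bounded, so that the supremum is meaningful.\<close>

lemma le_mat_norm_adjacency:
  fixes E :: "'v graph" and u f :: "'v \<Rightarrow> real"
  assumes fin: "\<And>x. finite (nbrs E x)" and "\<And>x. 0 < u x"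
    and "\<And>x. (\<Sum>y\<in>nbrs E x. u y) \<le> C * u x" and "0 \<le> C"
    and f: "(\<lambda>x. complex_of_real (f x)) \<in> ell2" "\<And>x. 0 < f x"
    and \<mu>: "0 \<le> \<mu>" "\<And>x. \<mu> * f x \<le> (\<Sum>y\<in>nbrs E x. f y)"
  shows "\<mu> \<le> mat_norm (adjacency E)"
proof -
  define s where "s = ell2_norm (\<lambda>x. complex_of_real (f x))"
  have s: "0 < s"
  proof -
    \<comment> \<open>\<open>undefined\<close> is just some vertex; one positive entry makes the
      norm positive.\<close>
    have "0 < (\<Sum>x\<in>{undefined}. (cmod (complex_of_real (f x)))\<^sup>2)"
      using f(2)[of undefined] by simp
    also have "\<dots> \<le> s\<^sup>2"
      unfolding s_def by (intro ell2_finite_sum_le f) simp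
    finally show ?thesis
      using ell2_norm_nonneg[of "\<lambda>x. complex_of_real (f x)"] by (auto simp: s_def order_less_le)
  qed
  define h where "h = (\<lambda>x. complex_of_real (f x / s))"
  have cmod_h: "cmod (h x) = cmod (complex_of_real (f x)) / s" for x
    using s by (simp add: h_def norm_divide)
  have sum_h: "(\<Sum>x\<in>F. (cmod (h x))\<^sup>2) \<le> 1\<^sup>2" if "finite F" for F
  proof -
    have "(\<Sum>x\<in>F. (cmod (h x))\<^sup>2) = (\<Sum>x\<in>F. (cmod (complex_of_real (f x)))\<^sup>2) / s\<^sup>2"
      by (simp add: cmod_h power_divide sum_divide_distrib)
    also have "\<dots> \<le> 1"
      using ell2_finite_sum_le[OF f(1) that] s by (simp add: s_def)
    finally show ?thesis by simp
  qed
  have h: "h \<in> ell2" "ell2_norm h \<le> 1"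
    using ell2_by_finite_sums[OF sum_h] by auto
  define t where "t = ell2_norm (mat_op (adjacency E) h)"
  have Ah: "mat_op (adjacency E) h \<in> ell2"
    by (rule schur_test[OF assms(1-3) h(1)])
  have lower: "\<mu> * f x / s \<le> cmod (mat_op (adjacency E) h x)" for x
  proof -
    have "mat_op (adjacency E) h x = complex_of_real ((\<Sum>y\<in>nbrs E x. f y) / s)"
      by (simp add: mat_op_adjacency[OF fin] h_def sum_divide_distrib)
    hence "cmod (mat_op (adjacency E) h x) = \<bar>(\<Sum>y\<in>nbrs E x. f y) / s\<bar>"
      using norm_of_real by metis
    thus ?thesis
      using \<mu>(2)[of x] s by (simp add: divide_right_mono)
  qed
  have "\<mu> \<le> t"
  proof (cases "\<mu> = 0")
    case True
    thus ?thesis by (simp add: t_def ell2_norm_nonneg)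
  next
    case False
    hence "0 < \<mu>" using \<mu>(1) by simp
    \<comment> \<open>The entrywise bound is read as an upper bound for \<open>f\<close> by
      \<open>s / \<mu>\<close> times the image, so the criterion by finite sums yields
      \<open>s \<le> t * s / \<mu>\<close>.\<close>
    have "(\<Sum>x\<in>F. (cmod (complex_of_real (f x)))\<^sup>2) \<le> (t * s / \<mu>)\<^sup>2" if "finite F" for F
    proof -
      have "(\<Sum>x\<in>F. (cmod (complex_of_real (f x)))\<^sup>2)
          = (\<Sum>x\<in>F. (\<mu> * f x / s)\<^sup>2) * (s / \<mu>)\<^sup>2"
        using s \<open>0 < \<mu>\<close>
          by (simp add: sum_distrib_right sum_divide_distrib power_mult_distrib power_divide)
      also have "\<dots> \<le> (\<Sum>x\<in>F. (cmod (mat_op (adjacency E) h x))\<^sup>2) * (s / \<mu>)\<^sup>2"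
        using lower f(2) s \<open>0 < \<mu>\<close>
        by (intro mult_right_mono sum_mono power_mono) (auto intro!: divide_nonneg_pos simp: less_imp_le)
      also have "\<dots> \<le> t\<^sup>2 * (s / \<mu>)\<^sup>2"
        unfolding t_def by (intro mult_right_mono ell2_finite_sum_le Ah that) simp
      finally show ?thesis
        by (simp add: power_mult_distrib power_divide)
    qed
    moreover have "0 \<le> t * s / \<mu>"
      using s \<open>0 < \<mu>\<close> by (simp add: t_def ell2_norm_nonneg)
    ultimately have "s \<le> t * s / \<mu>"
      unfolding s_def by (rule ell2_by_finite_sums)
    thus ?thesis
      using s \<open>0 < \<mu>\<close> by (simp add: field_simps)
  qed
  also have "t \<le> mat_norm (adjacency E)"
    unfolding mat_norm_def t_def
  proof (rule cSUP_upper)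
    show "h \<in> {f \<in> ell2. ell2_norm f \<le> 1}"
      using h by simp
    show "bdd_above ((\<lambda>f. ell2_norm (mat_op (adjacency E) f)) ` {f \<in> ell2. ell2_norm f \<le> 1})"
    proof (rule bdd_aboveI2)
      fix f :: "'v \<Rightarrow> complex" assume "f \<in> {f \<in> ell2. ell2_norm f \<le> 1}"
      thus "ell2_norm (mat_op (adjacency E) f) \<le> C"
        using schur_test(2)[OF assms(1-3), of f] mult_left_le[of "ell2_norm f" C] assms(4) by simp
    qed
  qed
  finally show ?thesis .
qed

lemma perron_frobenius_adjacency_iff:
  assumes "\<And>x. finite (nbrs E x)" "bounded_mat (adjacency E)"
  shows "perron_frobenius (adjacency E) v \<longleftrightarrow>
    (\<forall>x. 0 < v x) \<and> (\<forall>x. (\<Sum>y\<in>nbrs E x. v y) = mat_norm (adjacency E) * v x)"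
proof -
  have "((\<lambda>y. adjacency E x y * v y) has_sum s) UNIV \<longleftrightarrow> (\<Sum>y\<in>nbrs E x. v y) = s" for x s
    using has_sum_adjacency[OF assms(1), of x v] has_sum_unique by fastforce
  thus ?thesis
    using assms(2) by (auto simp: perron_frobenius_def adjacency_eq)
qed

section \<open>Homogeneous trees seen from a connected core\<close>

definition connected_in :: "'v graph \<Rightarrow> 'v set \<Rightarrow> bool" where
  "connected_in E C \<longleftrightarrow> (\<forall>x\<in>C. \<forall>y\<in>C. (\<lambda>x y. y \<in> nbrs E x \<and> x \<in> C \<and> y \<in> C)\<^sup>*\<^sup>* x y)"

lemma connected_in_hub:
  assumes "\<And>x. x \<in> C \<Longrightarrow> (\<lambda>x y. y \<in> nbrs E x \<and> x \<in> C \<and> y \<in> C)\<^sup>*\<^sup>* x z"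
  shows "connected_in E C"
proof -
  have "symp (\<lambda>x y. y \<in> nbrs E x \<and> x \<in> C \<and> y \<in> C)"
    by (auto simp: symp_def nbrs_sym[of _ E])
  thus ?thesis
    unfolding connected_in_def using assms by (meson rtranclp_trans sympD symp_rtranclp)
qed

text \<open>A repetition is cut out: if the new first vertex already lies on the walk, the part of
  the walk from that vertex on is kept.\<close>

lemma distinct_walk_in:
  assumes "(\<lambda>x y. y \<in> nbrs E x \<and> x \<in> C \<and> y \<in> C)\<^sup>*\<^sup>* x z" "z \<in> C"
  shows "\<exists>xs. graph_walk E xs \<and> distinct xs \<and> set xs \<subseteq> C \<and> hd xs = x \<and> last xs = z"
  using assms
proof (induction rule: converse_rtranclp_induct)
  case base
  thus ?case
    by (intro exI[of _ "[z]"]) (simp add: graph_walk_def)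
next
  case (step x y)
  then obtain xs where xs: "graph_walk E xs" "distinct xs" "set xs \<subseteq> C" "hd xs = y" "last xs = z"
    by blast
  show ?case
  proof (cases "x \<in> set xs")
    case True
    then obtain as bs where "xs = as @ x # bs"
      by (meson split_list)
    with xs show ?thesis
      by (intro exI[of _ "x # bs"]) (auto simp: graph_walk_def successively_append_iff)
  next
    case False
    with xs step.hyps(1) show ?thesis
      by (intro exI[of _ "x # xs"]) (auto simp: graph_walk_def successively_Cons nbrs_def)
  qed
qed

text \<open>A simple walk inside \<open>C\<close> from \<open>y\<close> to a different
  \<open>z\<close> would close up to a cycle through \<open>x\<close>. This is the only way in which
  acyclicity enters below.\<close>

lemma tree_unique_nbr_in:
  assumes "is_tree E" "connected_in E C" "x \<notin> C"
    and "y \<in> nbrs E x" "y \<in> C" "z \<in> nbrs E x" "z \<in> C"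
  shows "y = z"
proof (rule ccontr)
  assume "y \<noteq> z"
  have "(\<lambda>x y. y \<in> nbrs E x \<and> x \<in> C \<and> y \<in> C)\<^sup>*\<^sup>* y z"
    using assms by (auto simp: connected_in_def)
  then obtain xs where xs: "graph_walk E xs" "distinct xs" "set xs \<subseteq> C" "hd xs = y" "last xs = z"
    using distinct_walk_in[OF _ \<open>z \<in> C\<close>] by blast
  have "2 \<le> length xs"
    using xs \<open>y \<noteq> z\<close> by (cases xs rule: remdups_adj.cases) (auto simp: graph_walk_def)
  hence "graph_cycle E (x # xs)"
    using xs assms by (auto simp: graph_cycle_def graph_walk_def successively_Cons nbrs_def insert_commute)
  thus False
    using \<open>is_tree E\<close> by (auto simp: is_tree_def)
qed

section \<open>Distance from the core; parents and children\<close>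

lemma graph_walk_iff_relpowp:
  "(\<exists>xs. graph_walk E xs \<and> hd xs = x \<and> last xs = z \<and> length xs = Suc k)
    \<longleftrightarrow> ((\<lambda>x y. y \<in> nbrs E x) ^^ k) x z"
proof (induction k arbitrary: x)
  case 0
  have "graph_walk E [x]" by (simp add: graph_walk_def)
  thus ?case by (fastforce simp: length_Suc_conv)
next
  case (Suc k)
  have "(\<exists>xs. graph_walk E xs \<and> hd xs = x \<and> last xs = z \<and> length xs = Suc (Suc k))
    \<longleftrightarrow> (\<exists>y. y \<in> nbrs E x \<and> (\<exists>xs. graph_walk E xs \<and> hd xs = y \<and> last xs = z \<and> length xs = Suc k))"
    (is "?L \<longleftrightarrow> ?R")
  proof
    assume ?L
    then obtain xs where xs: "graph_walk E xs" "hd xs = x" "last xs = z" "length xs = Suc (Suc k)"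
      by blast
    then obtain ys where ys: "xs = x # ys" "length ys = Suc k"
      by (auto simp: length_Suc_conv)
    with xs show ?R
      by (intro exI[of _ "hd ys"] conjI exI[of _ ys])
        (auto simp: graph_walk_def successively_Cons nbrs_def)
  next
    assume ?R
    then obtain xs where "hd xs \<in> nbrs E x" "graph_walk E xs" "last xs = z" "length xs = Suc k"
      by blast
    thus ?L
      by (intro exI[of _ "x # xs"]) (auto simp: graph_walk_def successively_Cons nbrs_def)
  qed
  also have "\<dots> \<longleftrightarrow> ((\<lambda>x y. y \<in> nbrs E x) ^^ Suc k) x z"
    unfolding Suc.IH using relpowp_Suc_I2[of "\<lambda>x y. y \<in> nbrs E x"] relpowp_Suc_D2[of k "\<lambda>x y. y \<in> nbrs E x"]
    by metis
  finally show ?case .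
qed

lemma graph_dist_eq_relpowp:
  "graph_dist E x z = (LEAST k. ((\<lambda>x y. y \<in> nbrs E x) ^^ k) x z)"
  by (simp only: graph_dist_def graph_walk_iff_relpowp)

text \<open>\<open>S\<close> will carry the loops. An arbitrary nonempty connected set covers both
  the bi-infinite path and its finite segments.\<close>

locale tree_core =
  fixes Q :: nat and G :: "'v graph" and S :: "'v set"
  assumes homogeneous: "homogeneous_tree Q G"
    and core_nonempty: "S \<noteq> {}"
    and core_connected: "connected_in G S"
begin

abbreviation "D x \<equiv> set_dist G x S"

lemma tree: "is_tree G"
  using homogeneous by (simp add: homogeneous_tree_def)

lemma not_nbr_self: "x \<notin> nbrs G x"
  using tree by (simp add: is_tree_def nbrs_def)

lemma bij_betw_nbrs: "bij_betw (\<lambda>y. {x, y}) (nbrs G x) {e \<in> G. x \<in> e}"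
proof (rule bij_betw_imageI)
  show "inj_on (\<lambda>y. {x, y}) (nbrs G x)"
    by (auto simp: inj_on_def doubleton_eq_iff)
  show "(\<lambda>y. {x, y}) ` nbrs G x = {e \<in> G. x \<in> e}"
  proof (intro subset_antisym subsetI)
    fix e assume e: "e \<in> {e \<in> G. x \<in> e}"
    then obtain y z where "e = {y, z}"
      using tree by (auto simp: is_tree_def wf_graph_def)
    with e show "e \<in> (\<lambda>y. {x, y}) ` nbrs G x"
      by (auto simp: nbrs_def insert_commute)
  qed (auto simp: nbrs_def)
qed

lemma finite_nbrs [simp, intro]: "finite (nbrs G x)"
  and card_nbrs: "card (nbrs G x) = Q"
  using bij_betw_finite[OF bij_betw_nbrs, of x] bij_betw_same_card[OF bij_betw_nbrs, of x] homogeneous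
  by (auto simp: homogeneous_tree_def)

lemma relpowp_nbrs_exists: "\<exists>k. ((\<lambda>x y. y \<in> nbrs G x) ^^ k) x z"
proof -
  obtain xs where xs: "graph_walk G xs" "hd xs = x" "last xs = z"
    using tree unfolding is_tree_def graph_connected_def by blast
  then obtain k where "length xs = Suc k"
    by (auto simp: graph_walk_def neq_Nil_conv)
  with xs show ?thesis
    using graph_walk_iff_relpowp by metis
qed

lemma relpowp_graph_dist: "((\<lambda>x y. y \<in> nbrs G x) ^^ graph_dist G x z) x z"
  unfolding graph_dist_eq_relpowp using relpowp_nbrs_exists by (rule LeastI_ex)

lemma graph_dist_le: "((\<lambda>x y. y \<in> nbrs G x) ^^ k) x z \<Longrightarrow> graph_dist G x z \<le> k"
  unfolding graph_dist_eq_relpowp by (rule Least_le)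

lemma D_le: "z \<in> S \<Longrightarrow> D x \<le> graph_dist G x z"
  unfolding set_dist_def by (rule cINF_lower) auto

lemma D_attained: "\<exists>z\<in>S. D x = graph_dist G x z"
  unfolding set_dist_def using Inf_nat_def1[of "graph_dist G x ` S"] core_nonempty by auto

lemma D_eq_0_iff: "D x = 0 \<longleftrightarrow> x \<in> S"
proof
  assume "D x = 0"
  then obtain z where "z \<in> S" "graph_dist G x z = 0"
    using D_attained[of x] by auto
  thus "x \<in> S"
    using relpowp_graph_dist[of x z] by simp
next
  assume "x \<in> S"
  moreover have "graph_dist G x x \<le> 0"
    by (rule graph_dist_le) simp
  ultimately show "D x = 0"
    using D_le[of x x] by simp
qed

lemma D_nbr_le:
  assumes "y \<in> nbrs G x"
  shows "D x \<le> Suc (D y)"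
proof -
  obtain z where z: "z \<in> S" "D y = graph_dist G y z"
    using D_attained by blast
  have "graph_dist G x z \<le> Suc (D y)"
    using relpowp_graph_dist[of y z] assms z by (intro graph_dist_le) (metis relpowp_Suc_I2)
  thus ?thesis
    using D_le[OF z(1), of x] by simp
qed

text \<open>The first step of a shortest walk to a nearest core vertex brings the distance down, and
  by \<open>D_nbr_le\<close> by no more than one.\<close>

lemma exists_closer_nbr:
  assumes "x \<notin> S"
  shows "\<exists>y\<in>nbrs G x. D x = Suc (D y)"
proof -
  obtain z where z: "z \<in> S" "D x = graph_dist G x z"
    using D_attained by blast
  then obtain k where k: "D x = Suc k"
    using assms D_eq_0_iff[of x] not0_implies_Suc by metis
  have "((\<lambda>x y. y \<in> nbrs G x) ^^ Suc k) x z"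
    using relpowp_graph_dist[of x z] z k by simp
  then obtain y where y: "y \<in> nbrs G x" "((\<lambda>x y. y \<in> nbrs G x) ^^ k) y z"
    by (blast dest: relpowp_Suc_D2)
  hence "D y \<le> k"
    using D_le[OF z(1), of y] graph_dist_le[OF y(2)] by simp
  thus ?thesis
    using D_nbr_le[OF y(1)] y(1) k by force
qed

text \<open>Closer neighbours lead from any vertex of the ball down to the core without leaving the
  ball, and the core itself is connected.\<close>

lemma ball_connected: "connected_in G {x. D x \<le> k}"
proof -
  obtain s where s: "s \<in> S"
    using core_nonempty by blast
  show ?thesis
  proof (rule connected_in_hub)
    fix x assume "x \<in> {x. D x \<le> k}"
    thus "(\<lambda>x y. y \<in> nbrs G x \<and> x \<in> {x. D x \<le> k} \<and> y \<in> {x. D x \<le> k})\<^sup>*\<^sup>* x s" (is "?R\<^sup>*\<^sup>* x s")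
    proof (induction "D x" arbitrary: x)
      case 0
      hence "x \<in> S"
        using D_eq_0_iff by metis
      hence "(\<lambda>x y. y \<in> nbrs G x \<and> x \<in> S \<and> y \<in> S)\<^sup>*\<^sup>* x s"
        using core_connected s by (auto simp: connected_in_def)
      moreover have "z \<in> S \<Longrightarrow> D z = 0" for z
        using D_eq_0_iff by blast
      ultimately show ?case
        by (elim rtranclp_mono[THEN predicate2D, rotated]) auto
    next
      case (Suc n)
      hence "x \<notin> S"
        using D_eq_0_iff[of x] by simp
      then obtain y where y: "y \<in> nbrs G x" "D x = Suc (D y)"
        using exists_closer_nbr by blast
      hence "?R\<^sup>*\<^sup>* y s"
        using Suc by auto
      moreover have "?R x y"
        using y Suc.prems by auto
      ultimately show ?case
        by (rule converse_rtranclp_into_rtranclp[rotated])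
    qed
  qed
qed

lemma closer_nbr_unique:
  assumes "y \<in> nbrs G x" "D x = Suc (D y)" "z \<in> nbrs G x" "D x = Suc (D z)"
  shows "y = z"
  using assms by (intro tree_unique_nbr_in[OF tree ball_connected[of "D y"], of x]) auto

text \<open>A ball around the core stays connected when one vertex of the next sphere is added, so an edge
  inside a sphere would close a cycle.\<close>

lemma nbr_D_neq:
  assumes "y \<in> nbrs G x" "x \<notin> S"
  shows "D y \<noteq> D x"
proof
  assume eq: "D y = D x"
  hence "y \<notin> S"
    using assms(2) D_eq_0_iff by metis
  obtain x' where x': "x' \<in> nbrs G x" "D x = Suc (D x')"
    using exists_closer_nbr[OF assms(2)] by blast
  obtain y' where y': "y' \<in> nbrs G y" "D y = Suc (D y')"
    using exists_closer_nbr[OF \<open>y \<notin> S\<close>] by blast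
  define B where "B = {z. D z \<le> D x'}"
  have "connected_in G (insert y B)"
  proof (rule connected_in_hub[where z = x'])
    fix z assume z: "z \<in> insert y B"
    let ?R = "\<lambda>u v. v \<in> nbrs G u \<and> u \<in> insert y B \<and> v \<in> insert y B"
    have in_B: "?R\<^sup>*\<^sup>* z x'" if "z \<in> B" for z
    proof -
      have "(\<lambda>u v. v \<in> nbrs G u \<and> u \<in> B \<and> v \<in> B)\<^sup>*\<^sup>* z x'"
        using ball_connected[of "D x'"] that by (auto simp: connected_in_def B_def)
      thus ?thesis
        by (rule rtranclp_mono[THEN predicate2D, rotated]) auto
    qed
    moreover have "?R y y'" "y' \<in> B"
      using y' eq x' by (auto simp: B_def)
    ultimately show "?R\<^sup>*\<^sup>* z x'"
      using z by (metis (no_types, lifting) converse_rtranclp_into_rtranclp insertE)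
  qed
  moreover have "x \<notin> insert y B"
    using assms(1) not_nbr_self x' by (auto simp: B_def)
  ultimately have "y = x'"
    using assms(1) x' by (elim tree_unique_nbr_in[OF tree]) (auto simp: B_def)
  thus False
    using eq x' by simp
qed

text \<open>Off the core, distances of neighbours differ by exactly one and only one neighbour is
  closer. Thus \<open>y\<close> is the parent of \<open>x\<close> and \<open>C\<close> the set of
  its \<open>Q - 1\<close> children.\<close>

lemma nbrs_split:
  assumes "x \<notin> S"
  obtains y C where "nbrs G x = insert y C" "y \<notin> C" "D x = Suc (D y)"
    "finite C" "Suc (card C) = Q" "\<And>z. z \<in> C \<Longrightarrow> D z = Suc (D x) \<and> x \<in> nbrs G z"
proof -
  obtain y where y: "y \<in> nbrs G x" "D x = Suc (D y)"
    using exists_closer_nbr[OF assms] by blast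
  show ?thesis
  proof
    show "nbrs G x = insert y (nbrs G x - {y})"
      using y by blast
    show "Suc (card (nbrs G x - {y})) = Q"
      using card_Suc_Diff1[OF finite_nbrs y(1)] card_nbrs by simp
    fix z assume z: "z \<in> nbrs G x - {y}"
    hence "D z \<noteq> D x" "D x \<noteq> Suc (D z)"
      using nbr_D_neq[of z x] assms closer_nbr_unique[OF y] by blast+
    moreover have "D z \<le> Suc (D x)" "D x \<le> Suc (D z)"
      using z D_nbr_le[of x z] D_nbr_le[of z x] by (auto simp: nbrs_sym[of z])
    ultimately show "D z = Suc (D x) \<and> x \<in> nbrs G z"
      using z by (auto simp: nbrs_sym[of x])
  qed (use y in auto)
qed

text \<open>Minimum principle: at a zero of \<open>z\<close> the inequality makes the nonnegative
  values at all neighbours sum to zero, so zeros spread along the edges of the connected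
  tree.\<close>

lemma nonneg_eigenfunction_zero:
  fixes z :: "'v \<Rightarrow> real"
  assumes "\<And>x. 0 \<le> z x" "\<And>x. (\<Sum>y\<in>nbrs G x. z y) \<le> c x * z x" "z r = 0"
  shows "z x = 0"
proof -
  have step: "z v = 0" if "z u = 0" "v \<in> nbrs G u" for u v
    using that assms(1) assms(2)[of u] sum_nonneg_0[of "nbrs G u" z v] sum_nonneg[of "nbrs G u" z]
    by simp
  obtain k where "((\<lambda>x y. y \<in> nbrs G x) ^^ k) r x"
    using relpowp_nbrs_exists by blast
  thus ?thesis
    by (induction k arbitrary: x) (use assms(3) step in auto)
qed

lemma branch_sum:
  fixes w :: "'v \<Rightarrow> real"
  assumes w: "\<And>x y. y \<in> nbrs G x \<Longrightarrow> D x = Suc (D y) \<Longrightarrow> w x = a * w y"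
    and "a \<noteq> 0" "x \<notin> S"
  shows "(\<Sum>y\<in>nbrs G x. w y) = ((real Q - 1) * a + 1 / a) * w x"
proof -
  obtain y C where yC: "nbrs G x = insert y C" "y \<notin> C" "D x = Suc (D y)"
    "finite C" "Suc (card C) = Q" "\<And>z. z \<in> C \<Longrightarrow> D z = Suc (D x) \<and> x \<in> nbrs G z"
    using nbrs_split[OF \<open>x \<notin> S\<close>] by blast
  have "w x = a * w y"
    using w yC by auto
  moreover have "w z = a * w x" if "z \<in> C" for z
    using w[of x z] yC(6)[OF that] by simp
  hence "(\<Sum>z\<in>C. w z) = real (card C) * (a * w x)"
    by simp
  ultimately show ?thesis
    using yC \<open>a \<noteq> 0\<close> by (auto simp: field_simps)
qed

text \<open>Let \<open>t\<close> be the infimum of all child-to-parent ratios of \<open>u\<close>.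
  The eigenvalue equation turns the lower bound \<open>t\<close> for the children of
  \<open>x\<close> into the lower bound \<open>1 / (\<mu> - q * t)\<close> for the ratio at
  \<open>x\<close> itself. Hence \<open>t\<close> lies between the roots \<open>a\<close> and
  \<open>1 / (q * a)\<close> of \<open>q * t\<^sup>2 - \<mu> * t + 1\<close>.\<close>

lemma branch_lower:
  fixes u :: "'v \<Rightarrow> real"
  assumes pos: "\<And>x. 0 < u x"
    and eig: "\<And>x. x \<notin> S \<Longrightarrow> (\<Sum>y\<in>nbrs G x. u y) = ((real Q - 1) * a + 1 / a) * u x"
    and a: "0 < a" "(real Q - 1) * a\<^sup>2 < 1" and Q: "1 < Q"
    and xy: "y \<in> nbrs G x" "D x = Suc (D y)"
  shows "a * u y \<le> u x"
proof -
  define R where "R = {u x / u y | x y. y \<in> nbrs G x \<and> D x = Suc (D y)}"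
  define t where "t = Inf R"
  define q where "q = real Q - 1"
  define \<mu> where "\<mu> = q * a + 1 / a"
  have q: "0 < q" using Q by (simp add: q_def)
  have "R \<noteq> {}" using xy by (auto simp: R_def)
  have "bdd_below R"
    using pos by (intro bdd_belowI[of _ 0]) (auto simp: R_def less_imp_le)
  have t_le: "t * u y \<le> u x" if "y \<in> nbrs G x" "D x = Suc (D y)" for x y
  proof -
    have "t \<le> u x / u y"
      unfolding t_def using that by (intro cInf_lower \<open>bdd_below R\<close>) (auto simp: R_def)
    thus ?thesis
      using pos[of y] by (simp add: field_simps)
  qed
  have key: "u y \<le> (\<mu> - q * t) * u x" if "y \<in> nbrs G x" "D x = Suc (D y)" for x y
  proof -
    have "x \<notin> S"
      using that(2) D_eq_0_iff[of x] by simp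
    then obtain y' C where yC: "nbrs G x = insert y' C" "y' \<notin> C" "D x = Suc (D y')"
      "finite C" "Suc (card C) = Q" "\<And>z. z \<in> C \<Longrightarrow> D z = Suc (D x) \<and> x \<in> nbrs G z"
      using nbrs_split by blast
    have "y' = y"
      using closer_nbr_unique[of y' x y] that yC by simp
    have "(\<Sum>z\<in>C. t * u x) \<le> (\<Sum>z\<in>C. u z)"
      using yC by (intro sum_mono t_le) auto
    hence "u y + q * (t * u x) \<le> \<mu> * u x"
      using eig[OF \<open>x \<notin> S\<close>] yC \<open>y' = y\<close> by (auto simp: q_def \<mu>_def)
    thus ?thesis
      by (simp add: algebra_simps)
  qed
  have "0 < (\<mu> - q * t) * u x"
    using key[OF xy] pos[of y] by linarith
  hence m: "0 < \<mu> - q * t"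
    using pos[of x] by (simp add: zero_less_mult_iff)
  have "1 / (\<mu> - q * t) \<le> t"
    unfolding t_def
  proof (rule cInf_greatest[OF \<open>R \<noteq> {}\<close>], fold t_def)
    fix r assume "r \<in> R"
    then obtain x y where "r = u x / u y" "y \<in> nbrs G x" "D x = Suc (D y)"
      by (auto simp: R_def)
    thus "1 / (\<mu> - q * t) \<le> r"
      using key[of y x] m pos[of y] by (simp add: pos_le_divide_eq pos_divide_le_eq mult.commute)
  qed
  hence "1 \<le> t * (\<mu> - q * t)"
    using m by (simp add: field_simps)
  hence "(t - a) * (q * t - 1 / a) \<le> 0"
    using a(1) by (simp add: \<mu>_def field_simps)
  \<comment> \<open>By \<open>(Q - 1) * a\<^sup>2 < 1\<close> the root \<open>1 / (q * a)\<close>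
    exceeds \<open>a\<close>, so below \<open>a\<close> both factors would be negative.\<close>
  have "a \<le> t"
  proof (rule ccontr)
    assume "\<not> a \<le> t"
    hence "q * t < q * a"
      using q by simp
    also have "\<dots> < 1 / a"
      using a by (simp add: q_def field_simps power2_eq_square)
    finally have "0 < (t - a) * (q * t - 1 / a)"
      using \<open>\<not> a \<le> t\<close> by (intro mult_neg_neg) auto
    thus False
      using \<open>(t - a) * (q * t - 1 / a) \<le> 0\<close> by simp
  qed
  hence "a * u y \<le> t * u y"
    using pos[of y] by simp
  also have "\<dots> \<le> u x"
    by (rule t_le[OF xy])
  finally show ?thesis .
qed

text \<open>Spheres around the core grow at most by the factor \<open>Q - 1\<close> while the
  squared bound shrinks by \<open>a\<^sup>2\<close>, so the ratio test applies to the sums over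
  spheres.\<close>

lemma ell2_of_decay:
  fixes w :: "'v \<Rightarrow> real"
  assumes S: "finite S" and a: "0 < a" "(real Q - 1) * a\<^sup>2 < 1" and Q: "1 < Q"
    and w: "\<And>x. \<bar>w x\<bar> \<le> a ^ D x"
  shows "(\<lambda>x. complex_of_real (w x)) \<in> ell2"
proof -
  define L where "L k = {x. D x = k}" for k
  have L_0: "L 0 = S"
    using D_eq_0_iff by (auto simp: L_def)
  have L_sub: "L (Suc k) \<subseteq> (\<Union>y\<in>L k. {z \<in> nbrs G y. D z = Suc (D y)})" for k
  proof
    fix x assume x: "x \<in> L (Suc k)"
    hence "x \<notin> S"
      using D_eq_0_iff[of x] by (simp add: L_def)
    then obtain y where "y \<in> nbrs G x" "D x = Suc (D y)"
      using exists_closer_nbr by blast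
    thus "x \<in> (\<Union>y\<in>L k. {z \<in> nbrs G y. D z = Suc (D y)})"
      using x by (auto simp: L_def nbrs_sym[of x])
  qed
  have fin: "finite (L k)" for k
  proof (induction k)
    case (Suc k)
    show ?case
      by (rule finite_subset[OF L_sub]) (use Suc in auto)
  qed (simp add: L_0 S)
  \<comment> \<open>\<open>1 \<le> k\<close> matters: a core vertex has no parent, so up to
    \<open>Q\<close> of its neighbours may lie in the first sphere.\<close>
  have card_L: "card (L (Suc k)) \<le> (Q - 1) * card (L k)" if k: "1 \<le> k" for k
  proof -
    have "card (L (Suc k)) \<le> (\<Sum>y\<in>L k. card {z \<in> nbrs G y. D z = Suc (D y)})"
      by (rule order_trans[OF card_mono[OF _ L_sub] card_UN_le]) (use fin in auto)
    also have "\<dots> \<le> (\<Sum>y\<in>L k. Q - 1)"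
    proof (rule sum_mono)
      fix y assume "y \<in> L k"
      hence "y \<notin> S"
        using D_eq_0_iff[of y] k by (simp add: L_def)
      then obtain y' C where yC: "nbrs G y = insert y' C" "y' \<notin> C" "D y = Suc (D y')"
        "finite C" "Suc (card C) = Q"
        using nbrs_split by blast
      have "{z \<in> nbrs G y. D z = Suc (D y)} \<subseteq> C"
        using yC by auto
      thus "card {z \<in> nbrs G y. D z = Suc (D y)} \<le> Q - 1"
        using yC card_mono by force
    qed
    finally show ?thesis
      by (simp add: mult.commute)
  qed
  define s where "s k = real (card (L k)) * (a\<^sup>2) ^ k" for k
  have s_nonneg: "0 \<le> s k" for k
    by (simp add: s_def)
  have "summable s"
  proof (rule summable_ratio_test[OF a(2), of 1])
    fix k :: nat assume "1 \<le> k"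
    have "real (card (L (Suc k))) \<le> real ((Q - 1) * card (L k))"
      using card_L[OF \<open>1 \<le> k\<close>] by (rule of_nat_mono)
    also have "\<dots> = (real Q - 1) * card (L k)"
      using Q by (simp add: of_nat_diff)
    finally have "s (Suc k) \<le> (real Q - 1) * card (L k) * (a\<^sup>2) ^ Suc k"
      unfolding s_def by (intro mult_right_mono) auto
    thus "norm (s (Suc k)) \<le> (real Q - 1) * a\<^sup>2 * norm (s k)"
      using s_nonneg by (simp add: s_def mult_ac)
  qed
  have bound: "(\<Sum>x\<in>F. (cmod (complex_of_real (w x)))\<^sup>2) \<le> (sqrt (suminf s))\<^sup>2" if F: "finite F" for F
  proof -
    define K where "K = Suc (Max (insert 0 (D ` F)))"
    have D_K: "D x < K" if "x \<in> F" for x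
      using that F by (simp add: K_def less_Suc_eq_le)
    have "(\<Sum>x\<in>F. (cmod (complex_of_real (w x)))\<^sup>2) \<le> (\<Sum>x\<in>F. (a\<^sup>2) ^ D x)"
    proof (rule sum_mono)
      fix x
      have "(cmod (complex_of_real (w x)))\<^sup>2 \<le> (a ^ D x)\<^sup>2"
        using w[of x] by (intro power_mono) auto
      thus "(cmod (complex_of_real (w x)))\<^sup>2 \<le> (a\<^sup>2) ^ D x"
        by (simp add: power_mult[symmetric] mult.commute)
    qed
    also have "\<dots> \<le> (\<Sum>x\<in>(\<Union>k\<in>{..<K}. L k). (a\<^sup>2) ^ D x)"
      using D_K fin by (intro sum_mono2) (auto simp: L_def)
    also have "\<dots> = (\<Sum>k<K. \<Sum>x\<in>L k. (a\<^sup>2) ^ D x)"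
      using fin by (intro sum.UNION_disjoint) (auto simp: L_def)
    also have "\<dots> = (\<Sum>k<K. s k)"
      by (simp add: s_def L_def)
    also have "\<dots> \<le> suminf s"
      by (rule sum_le_suminf[OF \<open>summable s\<close>]) (use s_nonneg in auto)
    also have "\<dots> = (sqrt (suminf s))\<^sup>2"
      by (simp add: suminf_nonneg[OF \<open>summable s\<close> s_nonneg])
    finally show ?thesis .
  qed
  have "0 \<le> sqrt (suminf s)"
    by (simp add: suminf_nonneg[OF \<open>summable s\<close> s_nonneg])
  with bound show ?thesis
    by (rule ell2_by_finite_sums(1))
qed

text \<open>Following parents from \<open>x\<close> for \<open>D x\<close> steps ends at the core
  vertex \<open>\<pi> x\<close> from which the branch of \<open>x\<close> grows; \<open>w\<close>
  carries the value of \<open>h\<close> there, multiplied by \<open>a\<close> at each step.\<close>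

lemma exists_extension:
  "\<exists>w :: 'v \<Rightarrow> real. (\<forall>x. \<exists>s\<in>S. w x = a ^ D x * h s) \<and> (\<forall>x\<in>S. w x = h x) \<and>
    (\<forall>x y. y \<in> nbrs G x \<longrightarrow> D x = Suc (D y) \<longrightarrow> w x = a * w y)"
proof -
  \<comment> \<open>On the core the choice is arbitrary, but \<open>\<pi>\<close> applies
    \<open>par\<close> exactly \<open>D x\<close> times and hence only off the core.\<close>
  define par where "par x = (SOME y. y \<in> nbrs G x \<and> D x = Suc (D y))" for x
  define \<pi> where "\<pi> x = (par ^^ D x) x" for x
  have par_eq: "par x = y" if "y \<in> nbrs G x" "D x = Suc (D y)" for x y
    unfolding par_def using that closer_nbr_unique[of _ x y] by (intro some_equality) auto
  have \<pi>_step: "\<pi> x = \<pi> y" if "y \<in> nbrs G x" "D x = Suc (D y)" for x y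
    using par_eq[OF that] that by (simp add: \<pi>_def funpow_swap1)
  have \<pi>_core: "\<pi> x = x" if "x \<in> S" for x
    using that D_eq_0_iff[of x] by (simp add: \<pi>_def)
  have \<pi>_in: "\<pi> x \<in> S" for x
  proof (induction "D x" arbitrary: x)
    case 0
    thus ?case
      using D_eq_0_iff[of x] \<pi>_core by simp
  next
    case (Suc n)
    hence "x \<notin> S"
      using D_eq_0_iff[of x] by simp
    then obtain y where "y \<in> nbrs G x" "D x = Suc (D y)"
      using exists_closer_nbr by blast
    thus ?case
      using Suc \<pi>_step by simp
  qed
  define w where "w = (\<lambda>x. a ^ D x * h (\<pi> x))"
  have "\<forall>x. \<exists>s\<in>S. w x = a ^ D x * h s"
    using \<pi>_in by (auto simp: w_def)
  moreover have "\<forall>x\<in>S. w x = h x"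
    using \<pi>_core D_eq_0_iff[THEN iffD2] by (simp add: w_def)
  moreover have "\<forall>x y. y \<in> nbrs G x \<longrightarrow> D x = Suc (D y) \<longrightarrow> w x = a * w y"
    using \<pi>_step by (simp add: w_def)
  ultimately show ?thesis
    by blast
qed

section \<open>Eigenfunctions on the graph with loops at the core\<close>

abbreviation "E \<equiv> add_loops G S"

lemma nbrs_add_loops: "nbrs E x = (if x \<in> S then insert x (nbrs G x) else nbrs G x)"
  by (auto simp: nbrs_def add_loops_def doubleton_eq_iff)

lemma finite_nbrs_add_loops: "finite (nbrs E x)"
  by (simp add: nbrs_add_loops)

lemma sum_nbrs_add_loops:
  fixes w :: "'v \<Rightarrow> real"
  shows "(\<Sum>y\<in>nbrs E x. w y) = (\<Sum>y\<in>nbrs G x. w y) + (if x \<in> S then w x else 0)"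
  by (simp add: nbrs_add_loops not_nbr_self)

text \<open>At each step away from the core \<open>s * w\<close> is multiplied by exactly
  \<open>a\<close> and \<open>u\<close> by at least \<open>a\<close>, so
  \<open>s * w \<le> u\<close> spreads from the core to the whole tree. The difference is
  nonnegative and vanishes at \<open>r\<close>, so it is zero.\<close>

lemma eigenfunction_unique:
  fixes u w :: "'v \<Rightarrow> real"
  assumes pos: "\<And>x. 0 < u x"
    and u: "\<And>x. (\<Sum>y\<in>nbrs E x. u y) = ((real Q - 1) * a + 1 / a) * u x"
    and w: "\<And>x. (\<Sum>y\<in>nbrs E x. w y) = ((real Q - 1) * a + 1 / a) * w x"
    and decay: "\<And>x y. y \<in> nbrs G x \<Longrightarrow> D x = Suc (D y) \<Longrightarrow> w x = a * w y"
    and a: "0 < a" "(real Q - 1) * a\<^sup>2 < 1" and Q: "1 < Q"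
    and core: "\<And>x. x \<in> S \<Longrightarrow> s * w x \<le> u x"
    and touch: "u r = s * w r"
  shows "u x = s * w x"
proof -
  define z where "z x = u x - s * w x" for x
  have lower: "a * u y \<le> u x" if "y \<in> nbrs G x" "D x = Suc (D y)" for x y
  proof (rule branch_lower[OF pos _ a Q that])
    fix x assume "x \<notin> S"
    thus "(\<Sum>y\<in>nbrs G x. u y) = ((real Q - 1) * a + 1 / a) * u x"
      using u[of x] by (simp add: sum_nbrs_add_loops)
  qed
  have "s * w x \<le> u x" for x
  proof (induction "D x" arbitrary: x)
    case 0
    thus ?case
      using core D_eq_0_iff[of x] by simp
  next
    case (Suc n)
    hence "x \<notin> S"
      using D_eq_0_iff[of x] by simp
    then obtain y where y: "y \<in> nbrs G x" "D x = Suc (D y)"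
      using exists_closer_nbr by blast
    hence "s * w y \<le> u y"
      using Suc by simp
    hence "a * (s * w y) \<le> a * u y"
      using a by simp
    thus ?case
      using lower[OF y] decay[OF y] by (simp add: mult_ac)
  qed
  hence z: "0 \<le> z x" for x
    by (simp add: z_def)
  have "z x = 0"
  proof (rule nonneg_eigenfunction_zero[OF z, where r = r])
    fix x
    have "(\<Sum>y\<in>nbrs G x. z y) \<le> (\<Sum>y\<in>nbrs E x. z y)"
      using z by (simp add: sum_nbrs_add_loops)
    also have "\<dots> = (\<Sum>y\<in>nbrs E x. u y) - s * (\<Sum>y\<in>nbrs E x. w y)"
      by (simp add: z_def sum_subtractf sum_distrib_left)
    also have "\<dots> = ((real Q - 1) * a + 1 / a) * z x"
      by (simp add: u w z_def algebra_simps)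
    finally show "(\<Sum>y\<in>nbrs G x. z y) \<le> ((real Q - 1) * a + 1 / a) * z x" .
  qed (simp add: z_def touch)
  thus ?thesis
    by (simp add: z_def)
qed

end

section \<open>Loops along a path\<close>

lemma biinfinite_path_nbrs:
  assumes "biinfinite_path G p"
  shows "p (i + 1) \<in> nbrs G (p i)" "p (i - 1) \<in> nbrs G (p i)"
proof -
  have "{p i, p (i + 1)} \<in> G" "{p (i - 1), p (i - 1 + 1)} \<in> G"
    using assms unfolding biinfinite_path_def by blast+
  thus "p (i + 1) \<in> nbrs G (p i)" "p (i - 1) \<in> nbrs G (p i)"
    by (simp_all add: nbrs_def insert_commute)
qed

lemma biinfinite_path_connected:
  assumes p: "biinfinite_path G p"
    and I: "\<And>i j k. i \<in> I \<Longrightarrow> j \<in> I \<Longrightarrow> i \<le> k \<Longrightarrow> k \<le> j \<Longrightarrow> k \<in> I"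
  shows "connected_in G (p ` I)"
proof -
  let ?R = "\<lambda>x y. y \<in> nbrs G x \<and> x \<in> p ` I \<and> y \<in> p ` I"
  have up: "?R\<^sup>*\<^sup>* (p i) (p j)" if "i \<in> I" "i \<le> j" "j \<in> I" for i j
    using \<open>i \<le> j\<close> \<open>j \<in> I\<close>
  proof (induction j rule: int_ge_induct)
    case (step j)
    hence "j \<in> I"
      using I[of i "j + 1" j] \<open>i \<in> I\<close> by simp
    hence "?R\<^sup>*\<^sup>* (p i) (p j)" "?R (p j) (p (j + 1))"
      using step biinfinite_path_nbrs[OF p] by blast+
    thus ?case
      by (rule rtranclp.rtrancl_into_rtrancl)
  qed simp
  have "symp ?R"
    by (auto simp: symp_def nbrs_sym[of _ G])
  hence "symp ?R\<^sup>*\<^sup>*"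
    by (rule symp_rtranclp)
  hence "?R\<^sup>*\<^sup>* (p i) (p j)" if "i \<in> I" "j \<in> I" for i j
    using up[of i j] up[of j i] that by (cases "i \<le> j") (auto dest: sympD)
  thus ?thesis
    by (auto simp: connected_in_def)
qed

locale path_core =
  fixes Q :: nat and G :: "'v graph" and p :: "int \<Rightarrow> 'v" and I :: "int set"
  assumes homogeneous_tree: "homogeneous_tree Q G"
    and path: "biinfinite_path G p"
    and nonempty: "I \<noteq> {}"
    and interval: "\<And>i j k. i \<in> I \<Longrightarrow> j \<in> I \<Longrightarrow> i \<le> k \<Longrightarrow> k \<le> j \<Longrightarrow> k \<in> I"
begin

sublocale tree_core Q G "p ` I"
  using homogeneous_tree nonempty biinfinite_path_connected[OF path interval]
  by unfold_locales auto

lemma p_eq_iff [simp]: "p i = p j \<longleftrightarrow> i = j"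
  using path by (auto simp: biinfinite_path_def inj_eq)

text \<open>A chord of the path is impossible: the half-line starting at \<open>p (i + 1)\<close> or
  ending at \<open>p (i - 1)\<close> is connected and misses \<open>p i\<close>, hence contains a
  single neighbour of it.\<close>

lemma nbr_on_path:
  assumes "p j \<in> nbrs G (p i)"
  shows "j = i - 1 \<or> j = i + 1"
proof -
  have "i \<noteq> j"
    using assms not_nbr_self by blast
  then consider "i < j" | "j < i"
    by linarith
  thus ?thesis
  proof cases
    case 1
    have "p j = p (i + 1)"
    proof (rule tree_unique_nbr_in[OF tree])
      show "connected_in G (p ` {i + 1..})"
        by (rule biinfinite_path_connected[OF path]) auto
    qed (use 1 assms biinfinite_path_nbrs[OF path] in auto)
    thus ?thesis by simp
  next
    case 2
    have "p j = p (i - 1)"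
    proof (rule tree_unique_nbr_in[OF tree])
      show "connected_in G (p ` {..i - 1})"
        by (rule biinfinite_path_connected[OF path]) auto
    qed (use 2 assms biinfinite_path_nbrs[OF path] in auto)
    thus ?thesis by simp
  qed
qed

lemma leaving_nbr:
  assumes "i \<in> I" "y \<in> nbrs G (p i)" "y \<notin> p ` I"
  shows "D y = Suc (D (p i))" "p i \<in> nbrs G y"
proof -
  show *: "p i \<in> nbrs G y"
    using assms(2) nbrs_sym by metis
  have "D (p i) = 0" "D y \<noteq> 0"
    using D_eq_0_iff assms by auto
  thus "D y = Suc (D (p i))"
    using D_nbr_le[OF *] by simp
qed

text \<open>The path neighbours are listed apart even if they lie outside the core, so that end
  points and inner points of \<open>I\<close> obey one equation. The other \<open>Q - 2\<close>
  neighbours are always children.\<close>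

lemma core_nbrs_split:
  assumes "i \<in> I"
  obtains C where "nbrs G (p i) = insert (p (i - 1)) (insert (p (i + 1)) C)"
    "p (i - 1) \<notin> C" "p (i + 1) \<notin> C" "finite C" "card C + 2 = Q"
    "\<And>z. z \<in> C \<Longrightarrow> D z = Suc (D (p i)) \<and> p i \<in> nbrs G z"
proof
  define C where "C = nbrs G (p i) - {p (i - 1), p (i + 1)}"
  show eq: "nbrs G (p i) = insert (p (i - 1)) (insert (p (i + 1)) C)"
    using biinfinite_path_nbrs[OF path] by (auto simp: C_def)
  show "p (i - 1) \<notin> C" "p (i + 1) \<notin> C" "finite C"
    by (auto simp: C_def)
  thus "card C + 2 = Q"
    using card_nbrs[of "p i"] eq by simp
  show "D z = Suc (D (p i)) \<and> p i \<in> nbrs G z" if "z \<in> C" for z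
    using that nbr_on_path leaving_nbr[OF assms, of z] by (auto simp: C_def)
qed

text \<open>At \<open>p i\<close> the children in \<open>C\<close> contribute
  \<open>(Q - 2) * a * g i\<close> and the loop \<open>g i\<close>, which leaves
  \<open>(a + 1 / a - 1) * g i\<close> for the two path neighbours. At an end of \<open>I\<close>
  the path neighbour outside is itself a child, with value \<open>a * g i\<close>; hence
  \<open>right\<close> and \<open>left\<close>.\<close>

lemma eigen_equation:
  fixes w :: "'v \<Rightarrow> real"
  assumes decay: "\<And>x y. y \<in> nbrs G x \<Longrightarrow> D x = Suc (D y) \<Longrightarrow> w x = a * w y"
    and "a \<noteq> 0"
    and w: "\<And>i. i \<in> I \<Longrightarrow> w (p i) = g i"
    and g: "\<And>i. i \<in> I \<Longrightarrow> g (i - 1) + g (i + 1) = (a + 1 / a - 1) * g i"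
    and right: "\<And>i. i \<in> I \<Longrightarrow> i + 1 \<notin> I \<Longrightarrow> g (i + 1) = a * g i"
    and left: "\<And>i. i \<in> I \<Longrightarrow> i - 1 \<notin> I \<Longrightarrow> g (i - 1) = a * g i"
  shows "(\<Sum>y\<in>nbrs E x. w y) = ((real Q - 1) * a + 1 / a) * w x"
proof (cases "x \<in> p ` I")
  case False
  thus ?thesis
    using branch_sum[OF decay \<open>a \<noteq> 0\<close> False] by (simp add: sum_nbrs_add_loops)
next
  case True
  then obtain i where i: "i \<in> I" "x = p i"
    by blast
  obtain C where C: "nbrs G (p i) = insert (p (i - 1)) (insert (p (i + 1)) C)"
    "p (i - 1) \<notin> C" "p (i + 1) \<notin> C" "finite C" "card C + 2 = Q"
    "\<And>z. z \<in> C \<Longrightarrow> D z = Suc (D (p i)) \<and> p i \<in> nbrs G z"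
    using core_nbrs_split[OF i(1)] by blast
  have outside: "w (p j) = a * g i" if "j \<notin> I" "p j \<in> nbrs G (p i)" for j
    using leaving_nbr[OF i(1) that(2)] that(1) decay w[OF i(1)] by (metis imageE p_eq_iff)
  have "w (p (i + 1)) = g (i + 1)"
    using w[of "i + 1"] right[OF i(1)] outside[of "i + 1"] biinfinite_path_nbrs[OF path]
    by (cases "i + 1 \<in> I") auto
  moreover have "w (p (i - 1)) = g (i - 1)"
    using w[of "i - 1"] left[OF i(1)] outside[of "i - 1"] biinfinite_path_nbrs[OF path]
    by (cases "i - 1 \<in> I") auto
  moreover have "w z = a * g i" if "z \<in> C" for z
    using decay[of "p i" z] C(6)[OF that] w[OF i(1)] by simp
  hence "(\<Sum>z\<in>C. w z) = (real Q - 2) * (a * g i)"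
    using C(5) by auto
  ultimately have "(\<Sum>y\<in>nbrs E x. w y) = (g (i - 1) + g (i + 1)) + (real Q - 2) * (a * g i) + g i"
    using C True w[OF i(1)] by (simp add: sum_nbrs_add_loops i)
  thus ?thesis
    using g[OF i(1)] w[OF i(1)] by (simp add: i algebra_simps)
qed

end

text \<open>Increments of a concave sequence do not increase, so a positive increment
  \<open>d\<close> persists to the left, where the values would drop below zero. Reflection excludes
  negative increments.\<close>

lemma concave_pos_int_const:
  fixes g :: "int \<Rightarrow> real"
  assumes pos: "\<And>i. 0 < g i" and concave: "\<And>i. g (i - 1) + g (i + 1) \<le> 2 * g i"
  shows "g i = g 0"
proof -
  have mono: "h (i + 1) \<le> h i" if pos: "\<And>i. 0 < h i"
    and concave: "\<And>i. h (i - 1) + h (i + 1) \<le> 2 * h i" for h :: "int \<Rightarrow> real" and i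
  proof (rule ccontr)
    define d where "d = h (i + 1) - h i"
    assume "\<not> h (i + 1) \<le> h i"
    hence "0 < d"
      by (simp add: d_def)
    have descent: "h (i - int k) \<le> h i - k * d \<and> d \<le> h (i - int k + 1) - h (i - int k)" for k
    proof (induction k)
      case (Suc k)
      have "h (i - int k - 1) + h (i - int k + 1) \<le> 2 * h (i - int k)"
        by (rule concave)
      with Suc show ?case
        by (simp add: algebra_simps)
    qed (simp add: d_def)
    obtain k :: nat where "h i < k * d"
      using reals_Archimedean3[OF \<open>0 < d\<close>] by blast
    thus False
      using descent[of k] pos[of "i - int k"] by linarith
  qed
  have "g (i + 1) \<le> g i" for i
    by (rule mono[OF pos concave])
  moreover have "g i \<le> g (i + 1)" for i
  proof -
    have "(\<lambda>j. g (- j)) ((- i - 1) + 1) \<le> (\<lambda>j. g (- j)) (- i - 1)"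
    proof (rule mono)
      fix i :: int
      show "g (- (i - 1)) + g (- (i + 1)) \<le> 2 * g (- i)"
        using concave[of "- i"] by (simp add: add.commute minus_diff_commute)
    qed (rule pos)
    thus ?thesis
      by (simp add: algebra_simps)
  qed
  ultimately have step: "g (i + 1) = g i" for i
    by (simp add: order_antisym)
  show ?thesis
  proof (induction i rule: int_induct[where k = 0])
    case (step2 i)
    thus ?case
      using step[of "i - 1"] by simp
  qed (simp_all add: step)
qed

text \<open>The profile \<open>cos (\<theta> * i)\<close> satisfies the recursion on the path
  because \<open>a + 1 / a - 1 = 2 * cos \<theta>\<close>; the last equation in
  \<open>\<theta>\<close> matches it with the decay beyond the ends, and
  \<open>n * \<theta> < pi / 2\<close> keeps it positive. The conclusion records the facts about
  \<open>w\<close> that the passage to the limit uses.\<close>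

lemma segment_perron_frobenius:
  fixes Q :: nat and G :: "'v graph" and p :: "int \<Rightarrow> 'v" and n :: nat and \<theta> a :: real
  defines "S \<equiv> p ` {- int n..int n}" and "\<mu> \<equiv> (real Q - 1) * a + 1 / a"
  assumes Q: "2 \<le> Q" and G: "homogeneous_tree Q G" and p: "biinfinite_path G p"
    and a: "0 < a" "(real Q - 1) * a\<^sup>2 < 1"
    and \<theta>: "0 \<le> \<theta>" "n * \<theta> < pi / 2" "a + 1 / a = 1 + 2 * cos \<theta>"
      "cos ((real n + 1) * \<theta>) = a * cos (n * \<theta>)"
  shows "\<exists>w. normalized_ell2_pf (adjacency (add_loops G S)) (p 0) w \<and>
    (\<forall>u. normalized_ell2_pf (adjacency (add_loops G S)) (p 0) u \<longrightarrow> u = w) \<and>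
    (\<forall>i. \<bar>i\<bar> \<le> int n \<longrightarrow> w (p i) = cos (\<theta> * i)) \<and>
    (\<forall>x y. y \<in> nbrs G x \<longrightarrow> set_dist G x S = Suc (set_dist G y S) \<longrightarrow> w x = a * w y) \<and>
    (\<forall>x. (\<Sum>y\<in>nbrs (add_loops G S) x. w y) = \<mu> * w x) \<and>
    (\<forall>x. 0 < w x) \<and> (\<lambda>x. complex_of_real (w x)) \<in> ell2"
proof -
  interpret path_core Q G p "{- int n..int n}"
    using G p by unfold_locales auto
  have \<mu>: "0 \<le> \<mu>"
    using Q a by (simp add: \<mu>_def)
  have cos_pos: "0 < cos (\<theta> * i)" if "\<bar>i\<bar> \<le> int n" for i
  proof -
    have "\<bar>\<theta> * i\<bar> \<le> n * \<theta>"
    proof -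
      have "\<bar>real_of_int i\<bar> \<le> n"
        using that by linarith
      thus ?thesis
        using mult_left_mono[of "\<bar>real_of_int i\<bar>" n \<theta>] \<theta>(1) by (simp add: abs_mult mult.commute)
    qed
    thus ?thesis
      using \<theta>(2) by (intro cos_gt_zero_pi) linarith+
  qed
  obtain w where w: "\<And>x. \<exists>s\<in>p ` {- int n..int n}. w x = a ^ D x * cos (\<theta> * inv p s)"
    "\<And>x. x \<in> p ` {- int n..int n} \<Longrightarrow> w x = cos (\<theta> * inv p x)"
    "\<And>x y. y \<in> nbrs G x \<Longrightarrow> D x = Suc (D y) \<Longrightarrow> w x = a * w y"
    using exists_extension[of a "\<lambda>s. cos (\<theta> * inv p s)"] by blast
  have inv_p: "inv p (p i) = i" for i
    using path by (simp add: biinfinite_path_def)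
  have w_path: "w (p i) = cos (\<theta> * i)" if "\<bar>i\<bar> \<le> int n" for i
    using w(2)[of "p i"] that by (simp add: inv_p abs_le_iff)
  have w_range: "0 < w x \<and> w x \<le> a ^ D x" for x
  proof -
    obtain i where "i \<in> {- int n..int n}" "w x = a ^ D x * cos (\<theta> * inv p (p i))"
      using w(1)[of x] by blast
    hence "\<bar>i\<bar> \<le> int n" "w x = a ^ D x * cos (\<theta> * i)"
      by (auto simp: inv_p)
    thus ?thesis
      using a cos_pos by (simp add: mult_left_le)
  qed
  have w_eig: "(\<Sum>y\<in>nbrs E x. w y) = \<mu> * w x" for x
    unfolding \<mu>_def
  proof (rule eigen_equation[where g = "\<lambda>i. cos (\<theta> * i)"])
    have end_point: "cos (\<theta> * (real n + 1)) = a * cos (\<theta> * n)"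
      using \<theta>(4) by (simp add: mult.commute add.commute)
    fix i assume i: "i \<in> {- int n..int n}"
    show "w (p i) = cos (\<theta> * i)"
      using i by (intro w_path) auto
    show "cos (\<theta> * real_of_int (i - 1)) + cos (\<theta> * real_of_int (i + 1))
        = (a + 1 / a - 1) * cos (\<theta> * i)"
      by (simp add: \<theta>(3) algebra_simps cos_add cos_diff)
    show "cos (\<theta> * real_of_int (i + 1)) = a * cos (\<theta> * i)" if "i + 1 \<notin> {- int n..int n}"
    proof -
      have "i = int n"
        using i that by auto
      thus ?thesis
        using end_point by simp
    qed
    show "cos (\<theta> * real_of_int (i - 1)) = a * cos (\<theta> * i)" if "i - 1 \<notin> {- int n..int n}"
    proof -
      have "i = - int n"
        using i that by auto
      \<comment> \<open>Evenness of the cosine reduces the left end to the right end.\<close>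
      moreover have "cos (\<theta> * (- real n - 1)) = cos (\<theta> * (real n + 1))"
        by (subst cos_minus[symmetric]) (simp add: algebra_simps)
      ultimately show ?thesis
        using end_point by simp
    qed
  qed (use a w(3) in auto)
  have ell2: "(\<lambda>x. complex_of_real (w x)) \<in> ell2"
    using w_range a Q by (intro ell2_of_decay[of a]) (simp_all add: abs_of_pos)
  have fin: "finite (nbrs E x)" for x
    by (rule finite_nbrs_add_loops)
  have w_pos: "0 < w x" for x
    using w_range by blast
  have w_super: "(\<Sum>y\<in>nbrs E x. w y) \<le> \<mu> * w x" "\<mu> * w x \<le> (\<Sum>y\<in>nbrs E x. w y)" for x
    by (simp_all add: w_eig)
  \<comment> \<open>Both bounds use the same \<open>w\<close>: as an eigenvector it is a
    supersolution for the Schur test and, being square summable, also a test vector.\<close>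
  have norm: "mat_norm (adjacency E) = \<mu>"
    using mat_norm_adjacency_le[OF fin w_pos w_super(1) \<mu>]
      le_mat_norm_adjacency[OF fin w_pos w_super(1) \<mu> ell2 w_pos \<mu> w_super(2)]
    by simp
  have bdd: "bounded_mat (adjacency E)"
    by (rule bounded_mat_adjacency[OF fin w_pos w_super(1)])
  note pf_iff = perron_frobenius_adjacency_iff[OF fin bdd, unfolded norm]
  have w_root: "w (p 0) = 1"
    using w_path[of 0] by simp
  have unique: "u = w" if "normalized_ell2_pf (adjacency E) (p 0) u" for u
  proof -
    have u: "\<And>x. 0 < u x" "\<And>x. (\<Sum>y\<in>nbrs E x. u y) = \<mu> * u x" "u (p 0) = 1"
      using that by (auto simp: normalized_ell2_pf_def pf_iff)
    \<comment> \<open>The least ratio \<open>u x / w x\<close> over the finite core is attained, so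
      \<open>s * w\<close> touches \<open>u\<close> from below there.\<close>
    define T where "T = (\<lambda>x. u x / w x) ` p ` {- int n..int n}"
    have T: "finite T" "T \<noteq> {}"
      by (auto simp: T_def)
    define s where "s = Min T"
    have "s \<in> T"
      unfolding s_def by (rule Min_in[OF T])
    then obtain r where r: "r \<in> p ` {- int n..int n}" "s = u r / w r"
      by (auto simp: T_def)
    have *: "u x = s * w x" for x
    proof (rule eigenfunction_unique[OF u(1) u(2)[unfolded \<mu>_def] w_eig[unfolded \<mu>_def] w(3) a])
      fix x assume "x \<in> p ` {- int n..int n}"
      hence "s \<le> u x / w x"
        unfolding s_def using T by (intro Min_le) (auto simp: T_def)
      thus "s * w x \<le> u x"
        using w_pos[of x] by (simp add: field_simps)
    next
      show "u r = s * w r"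
        using r w_pos[of r] by simp
    qed (use Q in auto)
    hence "s = 1"
      using u(3) w_root *[of "p 0"] by simp
    thus ?thesis
      using * by auto
  qed
  have "normalized_ell2_pf (adjacency E) (p 0) w"
    using w_pos w_eig ell2 w_root by (simp add: normalized_ell2_pf_def pf_iff)
  thus ?thesis
    unfolding S_def using unique w_path w(3) w_eig w_pos ell2 by (intro exI[of _ w] conjI allI impI)
qed

section \<open>The constants and the limit\<close>

text \<open>On \<open>[0, pi / (2 * (n + 1))]\<close> the difference \<open>?F\<close> is
  nonnegative at 0, where it equals \<open>1 - \<alpha> 0\<close>, and nonpositive at the right end,
  where its first cosine vanishes. The intervals shrink to 0, which gives both limits.\<close>

lemma angle_sequence:
  obtains \<theta> a :: "nat \<Rightarrow> real" where "\<theta> \<longlonglongrightarrow> 0" and "a \<longlonglongrightarrow> (3 - sqrt 5) / 2"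
    and "\<And>n. 1 \<le> n \<Longrightarrow> 0 \<le> \<theta> n \<and> n * \<theta> n < pi / 2 \<and> 0 < a n \<and>
      a n + 1 / a n = 1 + 2 * cos (\<theta> n) \<and> cos ((real n + 1) * \<theta> n) = a n * cos (n * \<theta> n)"
proof -
  \<comment> \<open>\<open>\<alpha> t\<close> is the smaller root \<open>a\<close> of
    \<open>a + 1 / a = 1 + 2 * cos t\<close>; the roots are real, with product 1, when
    \<open>1 / 2 \<le> cos t\<close>.\<close>
  define \<alpha> :: "real \<Rightarrow> real" where
    "\<alpha> t = (1 + 2 * cos t - sqrt ((1 + 2 * cos t)\<^sup>2 - 4)) / 2" for t
  have cont: "continuous_on A \<alpha>" for A
    unfolding \<alpha>_def by (intro continuous_intros) simp
  have \<alpha>: "0 < \<alpha> t \<and> \<alpha> t + 1 / \<alpha> t = 1 + 2 * cos t" if "1 / 2 \<le> cos t" for t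
  proof -
    define b where "b = 1 + 2 * cos t"
    have b: "2 \<le> b"
      using that by (simp add: b_def)
    define r where "r = sqrt (b\<^sup>2 - 4)"
    have r2: "r\<^sup>2 = b\<^sup>2 - 4"
      using power_mono[OF b, of 2] by (simp add: r_def)
    have "r < b"
      unfolding r_def using b by (intro real_less_lsqrt) auto
    have "\<alpha> t = (b - r) / 2"
      by (simp add: \<alpha>_def b_def r_def)
    moreover have "(b - r) / 2 * ((b + r) / 2) = 1"
      using r2 by (simp add: field_simps power2_eq_square)
    hence "1 / ((b - r) / 2) = (b + r) / 2"
      using \<open>r < b\<close> by (simp add: field_simps)
    ultimately show ?thesis
      using \<open>r < b\<close> by (simp add: b_def[symmetric] add_divide_distrib diff_divide_distrib)
  qed
  have "\<exists>t::real. 0 \<le> t \<and> t \<le> pi / (2 * (real n + 1)) \<and> cos ((real n + 1) * t) = \<alpha> t * cos (n * t)"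
    if n: "1 \<le> n" for n :: nat
  proof -
    let ?F = "\<lambda>t::real. cos ((real n + 1) * t) - \<alpha> t * cos (n * t)"
    define e where "e = pi / (2 * (real n + 1))"
    \<comment> \<open>The bound by \<open>pi / 3\<close> comes from \<open>1 \<le> n\<close>; it
      gives \<open>1 / 2 \<le> cos e\<close>, where \<open>\<alpha>\<close> is a root.\<close>
    have e: "0 \<le> e" "(real n + 1) * e = pi / 2" "e \<le> pi / 3"
      using n by (auto simp: e_def field_simps)
    have "\<exists>t::real. 0 \<le> t \<and> t \<le> e \<and> ?F t = 0"
    proof (rule IVT2')
      have "cos (pi / 3) \<le> cos e"
        using e by (intro cos_monotone_0_pi_le) auto
      hence "0 < \<alpha> e"
        using \<alpha> by (simp add: cos_60)
      moreover have "0 \<le> n * e" "n * e \<le> pi / 2"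
        using e by (auto simp: algebra_simps)
      hence "0 \<le> cos (n * e)"
        by (intro cos_ge_zero) auto
      moreover have "cos ((real n + 1) * e) = 0"
        unfolding e(2) by (rule cos_pi_half)
      ultimately show "?F e \<le> 0"
        by simp
      have "1 \<le> sqrt 5"
        by simp
      thus "0 \<le> ?F 0"
        by (simp add: \<alpha>_def)
    qed (use e in \<open>auto intro!: continuous_intros cont\<close>)
    thus ?thesis
      unfolding e_def by (simp add: eq_diff_eq)
  qed
  then obtain \<theta> :: "nat \<Rightarrow> real" where \<theta>: "0 \<le> \<theta> n" "\<theta> n \<le> pi / (2 * (real n + 1))"
    "cos ((real n + 1) * \<theta> n) = \<alpha> (\<theta> n) * cos (n * \<theta> n)" if "1 \<le> n" for n
    by metis
  have "\<theta> \<longlonglongrightarrow> 0"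
  proof (rule tendsto_sandwich)
    show "\<forall>\<^sub>F n in sequentially. 0 \<le> \<theta> n" "\<forall>\<^sub>F n in sequentially. \<theta> n \<le> pi / 2 * (1 / Suc n)"
      using \<theta> by (auto intro!: eventually_sequentiallyI[of 1] simp: add.commute)
    have "(\<lambda>n. pi / 2 * (1 / Suc n)) \<longlonglongrightarrow> pi / 2 * 0"
      by (intro tendsto_mult tendsto_const LIMSEQ_Suc[OF lim_1_over_n])
    thus "(\<lambda>n. pi / 2 * (1 / Suc n)) \<longlonglongrightarrow> 0"
      by simp
  qed simp
  moreover have "isCont \<alpha> 0"
    using cont[of UNIV] by (simp add: continuous_on_eq_continuous_at)
  with \<open>\<theta> \<longlonglongrightarrow> 0\<close> have "(\<lambda>n. \<alpha> (\<theta> n)) \<longlonglongrightarrow> \<alpha> 0"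
    by (rule isCont_tendsto_compose[rotated])
  hence "(\<lambda>n. \<alpha> (\<theta> n)) \<longlonglongrightarrow> (3 - sqrt 5) / 2"
    by (simp add: \<alpha>_def)
  moreover have "0 \<le> \<theta> n \<and> n * \<theta> n < pi / 2 \<and> 0 < \<alpha> (\<theta> n) \<and>
      \<alpha> (\<theta> n) + 1 / \<alpha> (\<theta> n) = 1 + 2 * cos (\<theta> n) \<and> cos ((real n + 1) * \<theta> n) = \<alpha> (\<theta> n) * cos (n * \<theta> n)"
    if n: "1 \<le> n" for n
  proof -
    have "n * \<theta> n \<le> n * (pi / (2 * (real n + 1)))"
      using \<theta>(2)[OF n] by (intro mult_left_mono) auto
    also have "\<dots> < pi / 2"
      by (simp add: field_simps)
    finally have "n * \<theta> n < pi / 2" .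
    moreover have "pi / (2 * (real n + 1)) \<le> pi / 3"
      using n by (simp add: field_simps)
    hence "\<theta> n \<le> pi / 3"
      using \<theta>(2)[OF n] by linarith
    hence "cos (pi / 3) \<le> cos (\<theta> n)"
      using \<theta>(1)[OF n] by (intro cos_monotone_0_pi_le) auto
    ultimately show ?thesis
      using \<alpha>[of "\<theta> n"] \<theta>[OF n] by (simp add: cos_60)
  qed
  ultimately show thesis
    by (rule that)
qed

text \<open>The value \<open>(3 - sqrt 5) / 2\<close> of \<open>a\<close> does not depend on \<open>Q\<close>; the condition \<open>Q \<le> 7\<close> decides
  which of the two roots of \<open>(Q - 1) a\<^sup>2 - \<lambda>\<^sub>* a + 1 = 0\<close> is the smaller one.\<close>

lemma a_star:
  fixes Q :: nat
  assumes Q: "2 \<le> Q" "Q \<le> 7"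
  defines "a \<equiv> (3 - sqrt 5) / 2 :: real"
  shows "0 < a" "(real Q - 1) * a\<^sup>2 < 1" "a + 1 / a = 3"
    "(real Q - 1) * a + 1 / a = lambda_star Q" "a_fun Q (lambda_star Q) = a"
proof -
  have "sqrt 5 < (2.25 :: real)"
    by (rule real_less_lsqrt) (auto simp: power2_eq_square)
  have "(2.23 :: real) < sqrt 5"
    by (rule real_less_rsqrt) (auto simp: power2_eq_square)
  show a_pos: "0 < a"
    using \<open>sqrt 5 < 2.25\<close> by (simp add: a_def)
  have sqrt_a: "sqrt 5 = 3 - 2 * a"
    by (simp add: a_def field_simps)
  have a_sq: "a\<^sup>2 = 3 * a - 1"
    by (simp add: a_def power2_eq_square field_simps)
  show a_inv: "a + 1 / a = 3"
    using a_sq a_pos by (simp add: field_simps power2_eq_square)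
  \<comment> \<open>Sharp enough for both uses of \<open>Q \<le> 7\<close>:
    \<open>6 * a\<^sup>2 < 1\<close> and \<open>7 * a \<le> 3\<close>.\<close>
  have a_less: "a < 0.385"
    using \<open>2.23 < sqrt 5\<close> by (simp add: a_def)
  hence "a * a < 0.385 * 0.385"
    using a_pos by (intro mult_strict_mono) auto
  have "(real Q - 1) * a\<^sup>2 \<le> 6 * a\<^sup>2"
    using Q by (intro mult_right_mono) auto
  also have "\<dots> < 1"
    using \<open>a * a < 0.385 * 0.385\<close> by (simp add: power2_eq_square)
  finally show "(real Q - 1) * a\<^sup>2 < 1" .
  show l: "(real Q - 1) * a + 1 / a = lambda_star Q"
    using a_inv unfolding lambda_star_def sqrt_a by (simp add: algebra_simps)
  define l where "l = lambda_star Q"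
  have l_eq: "l = (real Q - 2) * a + 3"
    using l a_inv by (simp add: l_def algebra_simps)
  have l_pos: "0 < l"
    using l_eq a_pos Q by (simp add: add_nonneg_pos)
  have "real Q * a \<le> 7 * a"
    using Q a_pos by (intro mult_right_mono) auto
  hence root: "0 \<le> 3 - real Q * a"
    using a_less by simp
  \<comment> \<open>Since \<open>a\<^sup>2 - 3 * a + 1 = 0\<close>, the discriminant of
    \<open>(Q - 1) * x\<^sup>2 - l * x + 1\<close> is the square of \<open>3 - Q * a\<close>. By
    \<open>root\<close> its square root is \<open>3 - Q * a\<close> itself, so \<open>a_fun\<close>
    selects \<open>a\<close> and not the other root.\<close>
  have "l\<^sup>2 - 4 * (real Q - 1) - (3 - real Q * a)\<^sup>2 = 4 * (1 - real Q) * (a\<^sup>2 - 3 * a + 1)"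
    unfolding l_eq by algebra
  hence "l\<^sup>2 - 4 * (real Q - 1) = (3 - real Q * a)\<^sup>2"
    by (simp add: a_sq)
  hence "1 - 4 * (real Q - 1) / l\<^sup>2 = ((3 - real Q * a) / l)\<^sup>2"
    using l_pos by (simp add: field_simps)
  hence "sqrt (1 - 4 * (real Q - 1) / l\<^sup>2) = (3 - real Q * a) / l"
    using root l_pos by simp
  hence "a_fun Q l = (1 - (3 - real Q * a) / l) / (2 * (real Q - 1) / l)"
    by (simp add: a_fun_def)
  also have "\<dots> = a"
    using Q l_pos by (simp add: field_simps) (simp add: l_eq algebra_simps)
  finally show "a_fun Q (lambda_star Q) = a"
    by (simp add: l_def)
qed

theorem theorem4p3:
  fixes Q :: nat and G :: "'v graph" and root :: 'v and p :: "int \<Rightarrow> 'v" and v :: "'v \<Rightarrow> real"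
  assumes Q: "2 \<le> Q" "Q \<le> 7"
    and G: "homogeneous_tree Q G"
    and p: "biinfinite_path G p" "p 0 = root"
    and v: "\<And>x. v x = a_fun Q (lambda_star Q) ^ set_dist G x (range p)"
  shows "(\<forall>u. perron_frobenius (adjacency (add_loops G (range p))) u \<longleftrightarrow>
              (\<exists>c>0. \<forall>x. u x = c * v x)) \<and>
         (\<exists>N. (\<forall>n\<ge>N. \<exists>!w. normalized_ell2_pf
                  (adjacency (add_loops G (p ` {- int n..int n}))) root w) \<and>
              (\<forall>w :: nat \<Rightarrow> 'v \<Rightarrow> real.
                 (\<forall>n\<ge>N. normalized_ell2_pf
                    (adjacency (add_loops G (p ` {- int n..int n}))) root (w n)) \<longrightarrow>
                 (\<forall>x. (\<lambda>n. w n x) \<longlonglongrightarrow> v x)))"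
proof -
  interpret path_core Q G p UNIV
    using G p(1) by unfold_locales auto

  \<comment> \<open>The candidate \<open>v\<close> for loops along the whole path\<close>
  define a :: real where "a = (3 - sqrt 5) / 2"
  define \<mu> where "\<mu> = (real Q - 1) * a + 1 / a"
  note a = a_star[OF Q, folded a_def]
  have v_eq: "v x = a ^ D x" for x
    by (simp add: v a(5))
  have D_path: "D (p i) = 0" for i
    using D_eq_0_iff by auto
  have v_pos: "0 < v x" for x
    using a(1) by (simp add: v_eq)
  have v_path: "v (p i) = 1" for i
    by (simp add: v_eq D_path)
  have v_decay: "v x = a * v y" if "y \<in> nbrs G x" "D x = Suc (D y)" for x y
    using that by (simp add: v_eq)
  \<comment> \<open>On the path \<open>v\<close> is constant, which fits the recursion because
    \<open>a + 1 / a - 1 = 2\<close>; with \<open>UNIV\<close> as index set there are no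
    ends.\<close>
  have v_eig: "(\<Sum>y\<in>nbrs E x. v y) = \<mu> * v x" for x
    unfolding \<mu>_def
    by (rule eigen_equation[where g = "\<lambda>_. 1", OF v_decay]) (use a v_path in auto)
  have \<mu>_nonneg: "0 \<le> \<mu>"
    using Q a(1) by (simp add: \<mu>_def)

  \<comment> \<open>Eigenvectors for the finite segments\<close>
  obtain \<theta> b :: "nat \<Rightarrow> real" where \<theta>: "\<theta> \<longlonglongrightarrow> 0" and b: "b \<longlonglongrightarrow> a"
    and \<theta>b: "\<And>n. 1 \<le> n \<Longrightarrow> 0 \<le> \<theta> n \<and> n * \<theta> n < pi / 2 \<and> 0 < b n \<and>
      b n + 1 / b n = 1 + 2 * cos (\<theta> n) \<and> cos ((real n + 1) * \<theta> n) = b n * cos (n * \<theta> n)"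
    using angle_sequence unfolding a_def by blast
  \<comment> \<open>The strict inequality for \<open>a\<close> passes to \<open>b n\<close> for
    large \<open>n\<close>; together with \<open>1 \<le> n\<close> this determines
    \<open>N\<close>.\<close>
  have "(\<lambda>n. (real Q - 1) * (b n)\<^sup>2) \<longlonglongrightarrow> (real Q - 1) * a\<^sup>2"
    by (intro tendsto_intros b)
  hence "\<forall>\<^sub>F n in sequentially. (real Q - 1) * (b n)\<^sup>2 < 1"
    using a(2) by (rule order_tendstoD)
  then obtain N0 where N0: "\<And>n. N0 \<le> n \<Longrightarrow> (real Q - 1) * (b n)\<^sup>2 < 1"
    by (auto simp: eventually_sequentially)
  define N where "N = max 1 N0"
  define S where "S n = p ` {- int n..int n}" for n
  define \<mu>' where "\<mu>' n = (real Q - 1) * b n + 1 / b n" for n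

  define P where "P n w \<longleftrightarrow> normalized_ell2_pf (adjacency (add_loops G (S n))) root w \<and>
      (\<forall>u. normalized_ell2_pf (adjacency (add_loops G (S n))) root u \<longrightarrow> u = w) \<and>
      (\<forall>i. \<bar>i\<bar> \<le> int n \<longrightarrow> w (p i) = cos (\<theta> n * i)) \<and>
      (\<forall>x y. y \<in> nbrs G x \<longrightarrow> set_dist G x (S n) = Suc (set_dist G y (S n)) \<longrightarrow> w x = b n * w y) \<and>
      (\<forall>x. (\<Sum>y\<in>nbrs (add_loops G (S n)) x. w y) = \<mu>' n * w x) \<and>
      (\<forall>x. 0 < w x) \<and> (\<lambda>x. complex_of_real (w x)) \<in> ell2" for n w
  have "\<exists>w. P n w" if n: "N \<le> n" for n
  proof -
    have n': "1 \<le> n" "N0 \<le> n"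
      using n by (auto simp: N_def)
    have c: "0 < b n" "(real Q - 1) * (b n)\<^sup>2 < 1" "0 \<le> \<theta> n" "n * \<theta> n < pi / 2"
      "b n + 1 / b n = 1 + 2 * cos (\<theta> n)" "cos ((real n + 1) * \<theta> n) = b n * cos (n * \<theta> n)"
      using \<theta>b[OF n'(1)] N0[OF n'(2)] by blast+
    show ?thesis
      unfolding P_def S_def \<mu>'_def p(2)[symmetric]
      by (rule segment_perron_frobenius[OF Q(1) G p(1) c])
  qed
  then obtain W where P_W: "\<And>n. N \<le> n \<Longrightarrow> P n (W n)"
    by metis
  have W: "normalized_ell2_pf (adjacency (add_loops G (S n))) root (W n)"
    "\<And>u. normalized_ell2_pf (adjacency (add_loops G (S n))) root u \<Longrightarrow> u = W n"
    "\<And>i. \<bar>i\<bar> \<le> int n \<Longrightarrow> W n (p i) = cos (\<theta> n * i)"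
    "\<And>x y. y \<in> nbrs G x \<Longrightarrow> set_dist G x (S n) = Suc (set_dist G y (S n)) \<Longrightarrow> W n x = b n * W n y"
    "\<And>x. (\<Sum>y\<in>nbrs (add_loops G (S n)) x. W n y) = \<mu>' n * W n x"
    "\<And>x. 0 < W n x" "(\<lambda>x. complex_of_real (W n x)) \<in> ell2" if "N \<le> n" for n
    using P_W[OF that] unfolding P_def by blast+

  \<comment> \<open>The norm for the whole path\<close>
  have fin: "finite (nbrs E x)" for x
    by (rule finite_nbrs_add_loops)
  have v_super: "(\<Sum>y\<in>nbrs E x. v y) \<le> \<mu> * v x" for x
    by (simp add: v_eig)
  \<comment> \<open>The whole path has more loops than the segment, so the positive eigenvector
    \<open>W n\<close> is a square summable subsolution for it.\<close>
  have "\<mu>' n \<le> mat_norm (adjacency E)" if n: "N \<le> n" for n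
  proof (rule le_mat_norm_adjacency[OF fin v_pos v_super \<mu>_nonneg W(7)[OF n] W(6)[OF n]])
    have "0 < b n"
      using \<theta>b[of n] n by (simp add: N_def)
    thus "0 \<le> \<mu>' n"
      using Q by (simp add: \<mu>'_def)
    fix x
    have "nbrs (add_loops G (S n)) x \<subseteq> nbrs E x"
      by (auto simp: nbrs_def add_loops_def S_def)
    hence "(\<Sum>y\<in>nbrs (add_loops G (S n)) x. W n y) \<le> (\<Sum>y\<in>nbrs E x. W n y)"
      using W(6)[OF n] by (intro sum_mono2 fin) (auto simp: less_imp_le)
    thus "\<mu>' n * W n x \<le> (\<Sum>y\<in>nbrs E x. W n y)"
      by (simp add: W(5)[OF n])
  qed
  moreover have "\<mu>' \<longlonglongrightarrow> \<mu>"
    unfolding \<mu>'_def \<mu>_def using a(1) by (intro tendsto_intros b) auto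
  ultimately have "\<mu> \<le> mat_norm (adjacency E)"
    by (intro LIMSEQ_le_const2[of \<mu>']) auto
  hence norm: "mat_norm (adjacency E) = \<mu>"
    using mat_norm_adjacency_le[OF fin v_pos v_super \<mu>_nonneg] by simp
  have bdd: "bounded_mat (adjacency E)"
    by (rule bounded_mat_adjacency[OF fin v_pos v_super])
  note pf_iff = perron_frobenius_adjacency_iff[OF fin bdd, unfolded norm]

  \<comment> \<open>Uniqueness for the whole path\<close>
  have "\<exists>c>0. \<forall>x. u x = c * v x" if "perron_frobenius (adjacency E) u" for u
  proof -
    have u: "\<And>x. 0 < u x" "\<And>x. (\<Sum>y\<in>nbrs E x. u y) = \<mu> * u x"
      using that by (auto simp: pf_iff)
    have lower: "a * u y \<le> u x" if "y \<in> nbrs G x" "D x = Suc (D y)" for x y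
    proof (rule branch_lower[OF u(1) _ a(1,2) _ that])
      fix x assume "x \<notin> range p"
      thus "(\<Sum>y\<in>nbrs G x. u y) = ((real Q - 1) * a + 1 / a) * u x"
        using u(2)[of x] by (simp add: sum_nbrs_add_loops \<mu>_def)
    qed (use Q in auto)
    \<comment> \<open>The \<open>Q - 2\<close> branches take at least
      \<open>(Q - 2) * a * u (p i)\<close> and the loop takes \<open>u (p i)\<close>; of
      \<open>\<mu> = (Q - 2) * a + 3\<close> only 2 is left.\<close>
    have "u (p (i - 1)) + u (p (i + 1)) \<le> 2 * u (p i)" for i
    proof -
      obtain C where C: "nbrs G (p i) = insert (p (i - 1)) (insert (p (i + 1)) C)"
        "p (i - 1) \<notin> C" "p (i + 1) \<notin> C" "finite C" "card C + 2 = Q"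
        "\<And>z. z \<in> C \<Longrightarrow> D z = Suc (D (p i)) \<and> p i \<in> nbrs G z"
        using core_nbrs_split[of i] by blast
      have "(\<Sum>z\<in>C. a * u (p i)) \<le> (\<Sum>z\<in>C. u z)"
        using C(6) by (intro sum_mono lower) auto
      moreover have "real (card C) = real Q - 2"
        using C(5) by auto
      moreover have "u (p (i - 1)) + u (p (i + 1)) + (\<Sum>z\<in>C. u z) + u (p i) = \<mu> * u (p i)"
        using u(2)[of "p i"] C(1-4) by (simp add: sum_nbrs_add_loops)
      moreover have "\<mu> = (real Q - 2) * a + 3"
        using a(3) by (simp add: \<mu>_def algebra_simps)
      ultimately show ?thesis
        by (simp add: algebra_simps)
    qed
    hence const: "u (p i) = u (p 0)" for i
      using concave_pos_int_const[of "\<lambda>i. u (p i)"] u(1) by blast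
    have on_path: "u (p 0) * v x \<le> u x" if "x \<in> range p" for x
      using that const v_path by (metis rangeE mult.right_neutral order_refl)
    have "u x = u (p 0) * v x" for x
    proof (rule eigenfunction_unique[OF u(1) u(2)[unfolded \<mu>_def] v_eig[unfolded \<mu>_def] v_decay])
      show "u (p 0) = u (p 0) * v (p 0)"
        by (simp add: v_path)
    qed (use Q a(1,2) on_path in auto)
    thus ?thesis
      using u(1) by blast
  qed
  moreover have "perron_frobenius (adjacency E) u" if "0 < c" "\<forall>x. u x = c * v x" for u c
    using that v_pos v_eig by (simp add: pf_iff sum_distrib_left[symmetric])

  \<comment> \<open>Convergence of the segment eigenvectors\<close>
  moreover have "(\<lambda>n. W n x) \<longlonglongrightarrow> v x" for x
  proof -
    \<comment> \<open>As soon as the segment contains a nearest path vertex \<open>p j\<close> of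
      \<open>x\<close>, the two distances agree.\<close>
    have D_eq: "\<forall>\<^sub>F n in sequentially. set_dist G x (S n) = D x" for x
    proof -
      obtain j where j: "D x = graph_dist G x (p j)"
        using D_attained[of x] by auto
      show ?thesis
      proof (rule eventually_sequentiallyI[of "nat \<bar>j\<bar>"])
        fix n assume "nat \<bar>j\<bar> \<le> n"
        hence "p j \<in> S n"
          unfolding S_def by (intro imageI) auto
        hence "set_dist G x (S n) \<le> D x"
          unfolding j set_dist_def[of _ _ "S n"] by (intro cINF_lower) auto
        moreover have "D x \<le> set_dist G x (S n)"
          unfolding set_dist_def using \<open>p j \<in> S n\<close>
          by (intro cINF_superset_mono) (auto simp: S_def)
        ultimately show "set_dist G x (S n) = D x"
          by simp
      qed
    qed
    show ?thesis
    \<comment> \<open>On the path \<open>cos (\<theta> n * i)\<close> tends to \<open>cos 0\<close>;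
      each further step multiplies by \<open>b n\<close>, which tends to \<open>a\<close>.\<close>
    proof (induction "D x" arbitrary: x)
      case 0
      then obtain i where i: "x = p i"
        using D_eq_0_iff[of x] by auto
      have "(\<lambda>n. cos (\<theta> n * i)) \<longlonglongrightarrow> cos (0 * real_of_int i)"
        by (intro tendsto_intros \<theta>)
      moreover have "\<forall>\<^sub>F n in sequentially. cos (\<theta> n * i) = W n x"
        using W(3) by (intro eventually_sequentiallyI[of "max N (nat \<bar>i\<bar>)"]) (simp add: i nat_le_iff)
      ultimately show ?case
        by (simp add: i v_path Lim_transform_eventually)
    next
      case (Suc k)
      hence "x \<notin> range p"
        using D_eq_0_iff[of x] by simp
      then obtain y where y: "y \<in> nbrs G x" "D x = Suc (D y)"
        using exists_closer_nbr by blast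
      hence "(\<lambda>n. b n * W n y) \<longlonglongrightarrow> a * v y"
        using Suc by (intro tendsto_intros b) auto
      moreover have "\<forall>\<^sub>F n in sequentially. b n * W n y = W n x"
        using D_eq[of x] D_eq[of y] eventually_ge_at_top[of N]
        by eventually_elim (use W(4) y in auto)
      ultimately show ?case
        using v_decay[OF y] by (simp add: Lim_transform_eventually)
    qed
  qed
  hence "(\<lambda>n. w n x) \<longlonglongrightarrow> v x"
    if "\<forall>n\<ge>N. normalized_ell2_pf (adjacency (add_loops G (S n))) root (w n)" for w x
  proof (rule Lim_transform_eventually)
    show "\<forall>\<^sub>F n in sequentially. W n x = w n x"
      using that W(2) by (intro eventually_sequentiallyI[of N]) metis
  qed
  moreover have "\<exists>!w. normalized_ell2_pf (adjacency (add_loops G (S n))) root w" if "N \<le> n" for n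
    using W(1,2)[OF that] by blast
  ultimately show ?thesis
    unfolding S_def by blast
qed

end
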